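(* There exists a constant $\kappa>0$ such that for all integers $d\geq 1$, $n\geq 1$, $q\geq 2$ (with $\kappa$ independent of $d$, $n$ and $q$) and any $d$ nonzero masses $\mu_1,\ldots,\mu_d$ on $\mathbb{C}^{dn}$, there exists a collection of regular $q$-sectors $\{\mathcal{S}_{q,\lambda}\}_{\lambda\in S^1}$ centered about a complex hyperplane in $\mathbb{C}^{dn}$ such that $$\left\|\mu_j(\mathcal{S}_{q,\lambda})-\frac{\mu_j(\mathbb{C}^{dn})}{q}\right\|_2<\frac{\kappa}{\sqrt n}\,\mu_j(\mathbb{C}^{dn})$$ for each $1\leq j\leq d$.
   Context: A mass on $\mathbb{C}^N$ (identified with $\mathbb{R}^{2N}$) is a finite measure that is absolutely continuous with respect to Lebesgue measure. $S^1$ denotes the unit complex numbers, and $d\lambda$ is the normalized (total mass $1$) rotation-invariant measure on $S^1$. The norm $\|\cdot\|_2$ is the $L^2$-norm of functions of $\lambda\in S^1$ with respect to $d\lambda$: $\|f(\lambda)\|_2=\left(\int_{S^1}|f(\lambda)|^2\,d\lambda\right)^{1/2}$. A complex hyperplane in $\mathbb{C}^N$ is a complex affine subspace of complex codimension $1$ (a point if $N=1$); it can be written as $H_{\mathbb{C}}=\{\mathbf{u}\in\mathbb{C}^N\mid \langle \mathbf{u},\mathbf{a}\rangle_{\mathbb{C}}+\bar b=0\}$ with $\mathbf{a}\in\mathbb{C}^N\setminus\{\mathbf{0}\}$, $b\in\mathbb{C}$, $\|\mathbf{a}\|^2+|b|^2=1$, where $\langle\mathbf{u},\mathbf{a}\rangle_{\mathbb{C}}=\sum_{i=1}^N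 u_i\bar a_i$. A complex regular $q$-fan centered about $H_{\mathbb{C}}$ is the union of $q$ half-hyperplanes (halves of real hyperplanes) with common boundary $H_{\mathbb{C}}$ whose successive dihedral angles all equal $2\pi/q$; the resulting closed regions are called regular $q$-sectors. The regular $q$-sectors of all complex regular $q$-fans centered about $H_{\mathbb{C}}$ are parametrized by $\lambda\in S^1$ as $$\mathcal{S}_{q,\lambda}=\{\mathbf{u}\in\mathbb{C}^N\mid \langle\mathbf{u},\mathbf{a}\rangle_{\mathbb{C}}+\bar b=\lambda v \text{ for some } v\in\mathbb{C} \text{ with } v=0 \text{ or } |\arg v|\leq \pi/q\}.$$ Replacing $(\mathbf{a},b)$ by another unit vector defining the same hyperplane only replaces this family by a rotated parametrization $\lambda\mapsto\lambda\lambda_0$ with $\lambda_0 \in S^1$, so the $L^2$-norm above depends only on $H_{\mathbb{C}}$. *)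

theory Defs
  imports "HOL-Probability.Probability"
begin

section \<open>Masses on complex N-space\<close>

text \<open>
  Since the dimension is quantified inside the theorem (the constant must not depend on it),
  the vectors of complex \<open>N\<close>-space are the extensional functions from \<open>{..<N}\<close> to
  \<^typ>\<open>complex\<close>, which form the space of the following product measure. As \<^typ>\<open>complex\<close>
  carries its two-dimensional Lebesgue measure, this is the Lebesgue measure (on Borel sets) of
  real \<open>2N\<close>-space.
\<close>

definition lborel_C :: "nat \<Rightarrow> (nat \<Rightarrow> complex) measure" where
  "lborel_C N = Pi\<^sub>M {..<N} (\<lambda>_. lborel)"

abbreviation cspace :: "nat \<Rightarrow> (nat \<Rightarrow> complex) set" where
  "cspace N \<equiv> space (lborel_C N)"

lemma cspace_eq: "cspace N = {..<N} \<rightarrow>\<^sub>E UNIV"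
  by (simp add: lborel_C_def space_PiM)

definition mass :: "nat \<Rightarrow> (nat \<Rightarrow> complex) measure \<Rightarrow> bool" where
  "mass N \<mu> \<longleftrightarrow> finite_measure \<mu> \<and> sets \<mu> = sets (lborel_C N) \<and>
     absolutely_continuous (lborel_C N) \<mu>"


section \<open>Complex hyperplanes and regular sectors\<close>

definition cinner :: "nat \<Rightarrow> (nat \<Rightarrow> complex) \<Rightarrow> (nat \<Rightarrow> complex) \<Rightarrow> complex" where
  "cinner N u a = (\<Sum>i<N. u i * cnj (a i))"

definition hyperplane_coeffs :: "nat \<Rightarrow> (nat \<Rightarrow> complex) \<Rightarrow> complex \<Rightarrow> bool" where
  "hyperplane_coeffs N a b \<longleftrightarrow> a \<in> cspace N \<and> (\<exists>i<N. a i \<noteq> 0) \<and>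
     (\<Sum>i<N. (cmod (a i))\<^sup>2) + (cmod b)\<^sup>2 = 1"

definition hyperplane :: "nat \<Rightarrow> (nat \<Rightarrow> complex) \<Rightarrow> complex \<Rightarrow> (nat \<Rightarrow> complex) set" where
  "hyperplane N a b = {u \<in> cspace N. cinner N u a + cnj b = 0}"

definition complex_hyperplane :: "nat \<Rightarrow> (nat \<Rightarrow> complex) set \<Rightarrow> bool" where
  "complex_hyperplane N H \<longleftrightarrow> (\<exists>a b. hyperplane_coeffs N a b \<and> H = hyperplane N a b)"

definition sector ::
  "nat \<Rightarrow> nat \<Rightarrow> (nat \<Rightarrow> complex) \<Rightarrow> complex \<Rightarrow> complex \<Rightarrow> (nat \<Rightarrow> complex) set" where
  "sector N q a b z = {u \<in> cspace N. \<exists>v. cinner N u a + cnj b = z * v \<and>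
     (v = 0 \<or> \<bar>Arg v\<bar> \<le> pi / real q)}"

text \<open>
  \<open>S\<close> is the family of all regular \<open>q\<close>-sectors centered about \<open>H\<close>, parametrized by the unit
  circle through some choice of unit coefficient vector \<open>(a, b)\<close> for \<open>H\<close>; another choice
  rotates the parameter.
\<close>

definition regular_sectors ::
  "nat \<Rightarrow> nat \<Rightarrow> (nat \<Rightarrow> complex) set \<Rightarrow> (complex \<Rightarrow> (nat \<Rightarrow> complex) set) \<Rightarrow> bool" where
  "regular_sectors N q H S \<longleftrightarrow> (\<exists>a b. hyperplane_coeffs N a b \<and> H = hyperplane N a b \<and>
     (\<forall>z\<in>sphere 0 1. S z = sector N q a b z))"


section \<open>The $L^2$-norm on the unit circle\<close>

text \<open>Normalized arc length, i.e. the rotation-invariant probability measure on the circle.\<close>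

definition circle_measure :: "complex measure" where
  "circle_measure =
     distr (uniform_measure lborel {0..<2*pi}) (restrict_space borel (sphere 0 1)) cis"

definition circle_L2_norm :: "(complex \<Rightarrow> real) \<Rightarrow> real" where
  "circle_L2_norm f = sqrt (\<integral>z. \<bar>f z\<bar>\<^sup>2 \<partial>circle_measure)"

lemma space_circle_measure: "space circle_measure = sphere 0 1"
  by (simp add: circle_measure_def space_restrict_space)

lemma prob_space_circle_measure: "prob_space circle_measure"
proof -
  interpret U: prob_space "uniform_measure lborel {0..<2*pi}"
    by (rule prob_space_uniform_measure) auto
  have "cis \<in> borel_measurable borel"
    by (intro borel_measurable_continuous_onI continuous_intros)
  hence "cis \<in> uniform_measure lborel {0..<2*pi} \<rightarrow>\<^sub>M restrict_space borel (sphere 0 1)"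
    by (intro measurable_restrict_space2) auto
  thus ?thesis
    unfolding circle_measure_def by (rule U.prob_space_distr)
qed


section \<open>The norm is taken of a square-integrable function\<close>

text \<open>
  The Bochner integral in \<open>circle_L2_norm\<close> would be zero for a non-integrable function. The
  last lemma of this section shows that this does not occur for the functions the norm is
  applied to.
\<close>

lemma borel_measurable_Arg: "Arg \<in> borel_measurable borel"
proof -
  have "(\<lambda>x. indicat_real (- \<real>\<^sub>\<le>\<^sub>0) x *\<^sub>R Arg x) \<in> borel_measurable borel"
    by (intro borel_measurable_continuous_on_indicator continuous_on_Arg) auto
  hence 1: "(\<lambda>x::complex. if x = 0 then 0 else if Im x = 0 \<and> Re x \<le> 0 then pi
               else indicat_real (- \<real>\<^sub>\<le>\<^sub>0) x *\<^sub>R Arg x) \<in> borel_measurable borel"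
    by measurable
  have 2: "(if x = 0 then 0 else if Im x = 0 \<and> Re x \<le> 0 then pi
               else indicat_real (- \<real>\<^sub>\<le>\<^sub>0) x *\<^sub>R Arg x) = Arg x" for x
  proof (cases "x \<in> \<real>\<^sub>\<le>\<^sub>0")
    case True
    hence "x \<noteq> 0 \<Longrightarrow> Im x = 0 \<and> Re x < 0"
      by (auto simp: complex_nonpos_Reals_iff complex_eq_iff less_le)
    thus ?thesis by (cases "x = 0") (simp_all add: Arg_zero Arg_eq_pi[THEN iffD2])
  next
    case False
    thus ?thesis by (auto simp: complex_nonpos_Reals_iff)
  qed
  show ?thesis
    using 1 by (simp only: 2)
qed

lemma sector_eq:
  assumes "z \<in> sphere 0 1"
  shows "sector N q a b z = {u \<in> cspace N. cinner N u a + cnj b = 0 \<or>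
           \<bar>Arg (cnj z * (cinner N u a + cnj b))\<bar> \<le> pi / real q}"
proof -
  have [simp]: "z * cnj z = 1" "cnj z * z = 1" "z \<noteq> 0"
    using assms by (auto simp: complex_norm_square[symmetric] mult.commute)
  have "(\<exists>v. w = z * v \<and> (v = 0 \<or> \<bar>Arg v\<bar> \<le> pi / real q)) \<longleftrightarrow>
          w = 0 \<or> \<bar>Arg (cnj z * w)\<bar> \<le> pi / real q" (is "?l \<longleftrightarrow> ?r") for w
  proof
    assume ?l
    then obtain v where v: "w = z * v" "v = 0 \<or> \<bar>Arg v\<bar> \<le> pi / real q" by auto
    have "cnj z * w = v" by (simp add: v(1) flip: mult.assoc)
    with v show ?r by (metis mult_zero_right)
  next
    assume ?r
    moreover have "w = z * (cnj z * w)" by (simp flip: mult.assoc)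
    ultimately show ?l by (intro exI[of _ "cnj z * w"]) auto
  qed
  thus ?thesis by (simp add: sector_def)
qed

lemma sets_sector_joint:
  "{x \<in> space (circle_measure \<Otimes>\<^sub>M lborel_C N). cinner N (snd x) a + cnj b = 0 \<or>
      \<bar>Arg (cnj (fst x) * (cinner N (snd x) a + cnj b))\<bar> \<le> pi / real q}
    \<in> sets (circle_measure \<Otimes>\<^sub>M lborel_C N)"
proof -
  note borel_measurable_Arg[measurable]
  have [measurable]: "cnj \<in> borel_measurable borel"
    by (intro borel_measurable_continuous_onI continuous_intros)
  have [measurable]: "(\<lambda>u. cinner N u a) \<in> borel_measurable (lborel_C N)"
    unfolding cinner_def lborel_C_def 
  proof (intro borel_measurable_sum borel_measurable_times borel_measurable_const)
    fix i assume "i \<in> {..<N}"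
    thus "(\<lambda>u. u i) \<in> borel_measurable (Pi\<^sub>M {..<N} (\<lambda>_. lborel :: complex measure))"
      using measurable_component_singleton[of i "{..<N}" "\<lambda>_. lborel :: complex measure"] by simp
  qed
  have [measurable]: "(\<lambda>z. z) \<in> circle_measure \<rightarrow>\<^sub>M (borel :: complex measure)"
    unfolding circle_measure_def
    by (simp add: measurable_cong_sets[OF sets_distr refl] measurable_restrict_space1)
  have [measurable]: "fst \<in> circle_measure \<Otimes>\<^sub>M lborel_C N \<rightarrow>\<^sub>M (borel :: complex measure)"
    by (rule measurable_compose[OF measurable_fst, of "\<lambda>z. z", simplified]) measurable
  show ?thesis by measurable
qed

lemma circle_L2_norm_integrable:
  assumes "mass N \<mu>" and S: "regular_sectors N q H S"
  shows "integrable circle_measure (\<lambda>z. \<bar>measure \<mu> (S z) - c\<bar>\<^sup>2)"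
proof -
  interpret finite_measure \<mu> using assms by (simp add: mass_def)
  interpret C: prob_space circle_measure by (rule prob_space_circle_measure)
  have sets_mu: "sets \<mu> = sets (lborel_C N)" using assms by (simp add: mass_def)
  obtain a b where ab: "\<And>z. z \<in> sphere 0 1 \<Longrightarrow> S z = sector N q a b z"
    using S unfolding regular_sectors_def by blast
  define Q where "Q = {x \<in> space (circle_measure \<Otimes>\<^sub>M lborel_C N). cinner N (snd x) a + cnj b = 0 \<or>
      \<bar>Arg (cnj (fst x) * (cinner N (snd x) a + cnj b))\<bar> \<le> pi / real q}"
  have Q: "Q \<in> sets (circle_measure \<Otimes>\<^sub>M \<mu>)"
    using sets_sector_joint[of N a b q]
    by (simp add: Q_def sets_pair_measure_cong[OF refl sets_mu])
  have *: "Pair z -` Q = S z" if "z \<in> space circle_measure" for z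
    using that by (auto simp: Q_def ab sector_eq space_circle_measure space_pair_measure)
  have "(\<lambda>z. measure \<mu> (Pair z -` Q)) \<in> borel_measurable circle_measure"
    unfolding measure_def using measurable_emeasure_Pair[OF Q] by measurable
  hence meas: "(\<lambda>z. measure \<mu> (S z)) \<in> borel_measurable circle_measure"
    by (rule measurable_cong[THEN iffD1, rotated]) (simp add: *)
  show ?thesis
  proof (rule C.integrable_const_bound[where B = "(measure \<mu> (space \<mu>) + \<bar>c\<bar>)\<^sup>2"])
    have "\<bar>measure \<mu> (S z) - c\<bar>\<^sup>2 \<le> (measure \<mu> (space \<mu>) + \<bar>c\<bar>)\<^sup>2" for z
      using bounded_measure[of "S z"] measure_nonneg[of \<mu> "S z"] by (intro power_mono) linarith+
    thus "AE z in circle_measure. norm (\<bar>measure \<mu> (S z) - c\<bar>\<^sup>2) \<le> (measure \<mu> (space \<mu>) + \<bar>c\<bar>)\<^sup>2"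
      by simp
  qed (use meas in measurable)
qed

end

theory Submission
  imports Defs "HOL-Homology.Homology" "HOL-Number_Theory.Number_Theory"
begin

text \<open>
  Fix coefficients \<open>(a, b)\<close> and push each mass forward along the direction of
  \<open>\<langle>u, a\<rangle> + cnj b\<close> to a measure on the circle. The measure of a sector, as a function of the
  rotation parameter, is the convolution of this angular measure with the indicator of an arc of
  length \<open>2 \<pi> / q\<close>. If the Fourier coefficients of orders \<open>1, \<dots>, n\<close> of the angular measure vanish,
  then the \<open>L\<^sup>2\<close>-distance of the convolution from its mean is at most the total mass times the
  \<open>L\<^sup>2\<close>-norm of the Fourier tail of the arc. The arc has coefficients
  \<open>sin (\<pi> k / q) / (\<pi> k)\<close>, so this tail is at most \<open>sqrt (2 / (\<pi>\<^sup>2 n))\<close>, which is less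
  than \<open>1 / sqrt n\<close>, uniformly in \<open>q\<close>; the constant is \<open>\<kappa> = 1\<close>.

  It remains to make \<open>d n\<close> complex numbers vanish simultaneously, the coefficients of orders
  \<open>1, \<dots>, n\<close> of the \<open>d\<close> angular measures. They depend continuously on \<open>(a, b)\<close>, a point of the
  unit sphere of complex \<open>(d n + 1)\<close>-space, and the one of order \<open>k\<close> is multiplied by \<open>c ^ k\<close> when
  \<open>(a, b)\<close> is multiplied by a unit number \<open>c\<close>. So a Borsuk-Ulam theorem for the circle action
  applies (\<open>circle_equivariant_maps_common_zero\<close>). A common zero has \<open>a \<noteq> 0\<close>, since for \<open>a = 0\<close> the
  direction is constant and no moment vanishes.

  For the Borsuk-Ulam theorem the action is restricted to the cyclic group of a large prime order
  \<open>m\<close>, and each map is raised to a power that makes its weight \<open>1\<close> modulo \<open>m\<close>. The argument is then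
  the usual comparison of the Euler class of the quotient of the sphere with the cup length of a
  cover, carried out with chains and cochains of the sphere itself.
  Away from the zeros of the \<open>i\<close>-th map its argument labels points by integers modulo \<open>m\<close>, and the
  Bockstein of the labelling is an invariant integer \<open>2\<close>-cocycle. The cup product of these cocycles
  takes a value congruent to \<open>1\<close> modulo \<open>m\<close> on a chain that the acyclicity of the sphere provides
  (\<open>exists_euler_chain\<close>). If there were no common zero, then after subdivision every simplex would
  lie in a set on which one of the labels takes only two adjacent values, where the corresponding
  factor is zero (\<open>euler_power_eq_0\<close>).
\<close>

section \<open>Integer cochains evaluated on the vertices of singular simplices\<close>

text \<open>
  Recording a simplex by its list of vertices turns the faces of a simplex into deletions from a
  list, and cup products into recursive definitions on lists.
\<close>

definition vertices :: "nat \<Rightarrow> ((nat \<Rightarrow> real) \<Rightarrow> 'a) \<Rightarrow> 'a list" where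
  "vertices p \<sigma> = map (\<lambda>k. \<sigma> (\<lambda>j. if j = k then 1 else 0)) [0..<Suc p]"

definition evaluate :: "('a list \<Rightarrow> int) \<Rightarrow> nat \<Rightarrow> 'a chain \<Rightarrow> int" where
  "evaluate f p c = (\<Sum>\<sigma>\<in>Poly_Mapping.keys c. Poly_Mapping.lookup c \<sigma> * f (vertices p \<sigma>))"

text \<open>
  The recursion peels off the face opposite the first vertex. Every other face still contains that
  vertex and appears with the opposite sign, which gives the alternating sum of
  \<open>coboundary_eq_sum\<close>. In this form Leibniz rules are proved by unfolding two or three vertices.
\<close>

primrec coboundary :: "'a list \<Rightarrow> ('a list \<Rightarrow> int) \<Rightarrow> int" where
  "coboundary [] f = 0"
| "coboundary (x # xs) f = f xs - coboundary xs (\<lambda>ys. f (x # ys))"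

lemma coboundary_mult_left: "coboundary xs (\<lambda>ys. c * f ys) = c * coboundary xs f"
  by (induction xs arbitrary: f) (simp_all add: right_diff_distrib)

lemma coboundary_eq_sum:
  "coboundary xs f = (\<Sum>k<length xs. (- 1) ^ k * f (take k xs @ drop (Suc k) xs))"
proof (induction xs arbitrary: f)
  case (Cons x xs)
  show ?case
    by (simp add: Cons.IH sum.lessThan_Suc_shift sum_negf del: sum.lessThan_Suc)
qed simp

lemma length_vertices [simp]: "length (vertices p \<sigma>) = Suc p"
  by (simp add: vertices_def)

lemma evaluate_eq_lookup_frag_extend:
  "evaluate f p c =
     Poly_Mapping.lookup (frag_extend (\<lambda>\<sigma>. frag_cmul (f (vertices p \<sigma>)) (frag_of ())) c) ()"
  by (simp add: evaluate_def frag_extend_def lookup_sum)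

lemma evaluate_0 [simp]: "evaluate f p 0 = 0"
  by (simp add: evaluate_def)

lemma evaluate_of [simp]: "evaluate f p (frag_of \<sigma>) = f (vertices p \<sigma>)"
  by (simp add: evaluate_def)

lemma evaluate_diff: "evaluate f p (a - b) = evaluate f p a - evaluate f p b"
  by (simp add: evaluate_eq_lookup_frag_extend frag_extend_diff lookup_minus)

lemma evaluate_add: "evaluate f p (a + b) = evaluate f p a + evaluate f p b"
  by (simp add: evaluate_eq_lookup_frag_extend frag_extend_add lookup_add)

lemma evaluate_cmul: "evaluate f p (frag_cmul k c) = k * evaluate f p c"
  by (simp add: evaluate_eq_lookup_frag_extend frag_extend_cmul)

lemma evaluate_sum: "evaluate f p (\<Sum>i\<in>I. c i) = (\<Sum>i\<in>I. evaluate f p (c i))"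
  by (induction I rule: infinite_finite_induct) (simp_all add: evaluate_add)

lemma vertices_singular_face:
  assumes "k \<le> Suc p"
  shows "vertices p (singular_face (Suc p) k \<sigma>) =
           take k (vertices (Suc p) \<sigma>) @ drop (Suc k) (vertices (Suc p) \<sigma>)"
proof (rule nth_equalityI)
  fix i assume i: "i < length (vertices p (singular_face (Suc p) k \<sigma>))"
  have eq: "simplical_face k (\<lambda>j. if j = i then 1 else 0 :: real)
          = (\<lambda>j. if j = (if i < k then i else Suc i) then 1 else 0)"
    by (auto simp: simplical_face_def fun_eq_iff)
  have "vertices p (singular_face (Suc p) k \<sigma>) ! i =
        \<sigma> (\<lambda>j. if j = (if i < k then i else Suc i) then 1 else 0)"
    using i by (simp add: vertices_def singular_face_def eq del: upt_Suc)
  also have "\<dots> = (take k (vertices (Suc p) \<sigma>) @ drop (Suc k) (vertices (Suc p) \<sigma>)) ! i"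
    using i assms by (auto simp: vertices_def nth_append simp del: upt_Suc)
  finally show "vertices p (singular_face (Suc p) k \<sigma>) ! i = \<dots>" .
qed (use assms in auto)

lemma evaluate_chain_boundary:
  "evaluate f p (chain_boundary (Suc p) c) = evaluate (\<lambda>xs. coboundary xs f) (Suc p) c"
  using subset_UNIV
proof (induction c rule: frag_induction)
  case (one \<sigma>)
  have "evaluate f p (chain_boundary (Suc p) (frag_of \<sigma>)) =
        (\<Sum>k\<le>Suc p. (-1) ^ k * f (vertices p (singular_face (Suc p) k \<sigma>)))"
    by (simp add: chain_boundary_of evaluate_sum evaluate_cmul evaluate_add del: sum.atMost_Suc)
  also have "\<dots> = coboundary (vertices (Suc p) \<sigma>) f"
    unfolding coboundary_eq_sum length_vertices lessThan_Suc_atMost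
    by (intro sum.cong refl) (simp add: vertices_singular_face)
  finally show ?case by simp
qed (simp_all add: chain_boundary_diff evaluate_diff)

lemma vertices_simplex_map: "vertices p (simplex_map p g \<sigma>) = map g (vertices p \<sigma>)"
  by (simp add: vertices_def simplex_map_def)

lemma evaluate_chain_map: "evaluate f p (chain_map p g c) = evaluate (\<lambda>xs. f (map g xs)) p c"
  using subset_UNIV
  by (induction c rule: frag_induction) (simp_all add: chain_map_diff evaluate_diff vertices_simplex_map)

lemma vertices_in_topspace:
  assumes "singular_chain p X c" "\<sigma> \<in> Poly_Mapping.keys c"
  shows "set (vertices p \<sigma>) \<subseteq> topspace X"
proof -
  have "singular_simplex p X \<sigma>" using assms by (auto simp: singular_chain_def)
  thus ?thesis by (auto simp: vertices_def singular_simplex_def continuous_map_def Pi_iff)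
qed

lemma evaluate_cong:
  assumes "singular_chain p X c"
    and "\<And>xs. length xs = Suc p \<Longrightarrow> set xs \<subseteq> topspace X \<Longrightarrow> f xs = h xs"
  shows "evaluate f p c = evaluate h p c"
  unfolding evaluate_def
  by (intro sum.cong refl) (simp add: assms vertices_in_topspace[OF assms(1)])

lemma evaluate_cong_mod:
  assumes "singular_chain p X c"
    and "\<And>xs. length xs = Suc p \<Longrightarrow> set xs \<subseteq> topspace X \<Longrightarrow> [f xs = h xs] (mod m)"
  shows "[evaluate f p c = evaluate h p c] (mod m)"
  unfolding evaluate_def
  by (intro cong_sum cong_mult cong_refl) (simp add: assms vertices_in_topspace[OF assms(1)])

lemma evaluate_mult_left: "evaluate (\<lambda>xs. k * f xs) p c = k * evaluate f p c"
  by (simp add: evaluate_def sum_distrib_left mult_ac)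

lemma evaluate_add_left: "evaluate (\<lambda>xs. f xs + h xs) p c = evaluate f p c + evaluate h p c"
  by (simp add: evaluate_def sum.distrib distrib_left)

section \<open>Powers of the Bockstein class of a labelling modulo m\<close>

text \<open>
  The difference of two labels, lifted from the integers modulo \<open>m\<close> to \<open>{-1..m - 2}\<close>. With this
  range the lift is additive along points whose labels differ by at most \<open>1\<close>, provided
  \<open>m \<ge> 3\<close>.
\<close>

definition lift_diff :: "int \<Rightarrow> ('a \<Rightarrow> int) \<Rightarrow> 'a \<Rightarrow> 'a \<Rightarrow> int" where
  "lift_diff m s x y = (s y - s x + 1) mod m - 1"

text \<open>
  Modulo \<open>m\<close> the lifted differences form the coboundary of the labelling, so the coboundary of the
  lift is divisible by \<open>m\<close>.
\<close>

definition bockstein :: "int \<Rightarrow> ('a \<Rightarrow> int) \<Rightarrow> 'a \<Rightarrow> 'a \<Rightarrow> 'a \<Rightarrow> int" where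
  "bockstein m s x y z = (lift_diff m s x y + lift_diff m s y z - lift_diff m s x z) div m"

text \<open>
  The cup product of \<open>k\<close> Bockstein cocycles. Each factor may come from its own labelling: all of
  them represent the same equivariant class, and the evaluation below works factor by factor.
\<close>

fun euler_power :: "int \<Rightarrow> (nat \<Rightarrow> 'a \<Rightarrow> int) \<Rightarrow> nat \<Rightarrow> 'a list \<Rightarrow> int" where
  "euler_power m s 0 xs = 1"
| "euler_power m s (Suc k) (x # y # z # r) = bockstein m (s k) x y z * euler_power m s k (z # r)"
| "euler_power m s (Suc k) xs = 0"

lemma cong_lift_diff: "[lift_diff m s x y = s y - s x] (mod m)"
  unfolding lift_diff_def cong_def by (metis add_diff_cancel_right' mod_diff_left_eq)

lemma mult_bockstein:
  "m * bockstein m s x y z = lift_diff m s x y + lift_diff m s y z - lift_diff m s x z"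
proof -
  have "[lift_diff m s x y + lift_diff m s y z - lift_diff m s x z
         = (s y - s x) + (s z - s y) - (s z - s x)] (mod m)"
    by (intro cong_diff cong_add cong_lift_diff)
  hence "m dvd lift_diff m s x y + lift_diff m s y z - lift_diff m s x z"
    by (simp add: cong_0_iff)
  thus ?thesis by (simp add: bockstein_def)
qed

lemma bockstein_cocycle:
  assumes "m \<noteq> 0"
  shows "bockstein m s y z w - bockstein m s x z w + bockstein m s x y w - bockstein m s x y z = 0"
proof -
  have "m * (bockstein m s y z w - bockstein m s x z w + bockstein m s x y w - bockstein m s x y z) = 0"
    by (simp add: algebra_simps) (simp add: mult_bockstein)
  with assms show ?thesis by simp
qed

lemma coboundary_1: "even (length xs) \<Longrightarrow> coboundary xs (\<lambda>_. 1) = 0"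
  by (induction xs rule: induct_list012) simp_all

text \<open>
  The Leibniz rule; the terms that cancel between the two factors are the last face of the
  \<open>2\<close>-cochain and the first face of the remaining product.
\<close>

lemma coboundary_euler_power:
  assumes "m \<noteq> 0"
  shows "length xs = 2 * k + 2 \<Longrightarrow> coboundary xs (euler_power m s k) = 0"
proof (induction k arbitrary: xs)
  case 0
  have "euler_power m s 0 = (\<lambda>_. 1)" by (simp add: fun_eq_iff)
  with 0 show ?case by (simp add: coboundary_1)
next
  case (Suc k)
  then obtain x y z w r where xs: "xs = x # y # z # w # r" and r: "length r = 2 * k"
    by (auto simp: length_Suc_conv numeral_eq_Suc)
  have IH: "coboundary (w # r) (\<lambda>ys. euler_power m s k (z # ys)) = euler_power m s k (w # r)"
    using Suc.IH[of "z # w # r"] r by simp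
  have "coboundary xs (euler_power m s (Suc k)) =
     (bockstein m (s k) y z w - bockstein m (s k) x z w + bockstein m (s k) x y w) * euler_power m s k (w # r)
     - coboundary (w # r) (\<lambda>ys. bockstein m (s k) x y z * euler_power m s k (z # ys))"
    unfolding xs by (simp add: algebra_simps)
  also have "\<dots> = (bockstein m (s k) y z w - bockstein m (s k) x z w + bockstein m (s k) x y w
                     - bockstein m (s k) x y z) * euler_power m s k (w # r)"
    unfolding coboundary_mult_left IH by (simp add: algebra_simps)
  also have "\<dots> = 0" by (simp only: bockstein_cocycle[OF assms] mult_zero_left)
  finally show ?case .
qed

text \<open>
  The cup products of a \<open>0\<close>-cochain and of a \<open>1\<close>-cochain with a further cochain, which express
  \<open>euler_power\<close> through one factor less.
\<close>

fun cup_label :: "('a \<Rightarrow> int) \<Rightarrow> ('a list \<Rightarrow> int) \<Rightarrow> 'a list \<Rightarrow> int" where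
  "cup_label s \<gamma> (x # r) = s x * \<gamma> (x # r)"
| "cup_label s \<gamma> [] = 0"

fun cup_edge :: "('a \<Rightarrow> 'a \<Rightarrow> int) \<Rightarrow> ('a list \<Rightarrow> int) \<Rightarrow> 'a list \<Rightarrow> int" where
  "cup_edge L \<gamma> (x # y # r) = L x y * \<gamma> (y # r)"
| "cup_edge L \<gamma> xs = 0"

lemma coboundary_cup_label:
  assumes "coboundary (x # y # r) \<gamma> = 0"
  shows "coboundary (x # y # r) (cup_label s \<gamma>) = (s y - s x) * \<gamma> (y # r)"
proof -
  have "coboundary (x # y # r) (cup_label s \<gamma>) =
          s y * \<gamma> (y # r) - coboundary (y # r) (\<lambda>ys. s x * \<gamma> (x # ys))"
    by simp
  also have "\<dots> = s y * \<gamma> (y # r) - s x * \<gamma> (y # r)"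
    using assms by (subst coboundary_mult_left) simp
  finally show ?thesis by (simp add: left_diff_distrib)
qed

lemma coboundary_cup_edge:
  assumes "coboundary (y # z # r) \<gamma> = 0"
  shows "coboundary (x # y # z # r) (cup_edge L \<gamma>) = (L x y + L y z - L x z) * \<gamma> (z # r)"
proof -
  have "coboundary (x # y # z # r) (cup_edge L \<gamma>) =
          L y z * \<gamma> (z # r) - L x z * \<gamma> (z # r) + coboundary (z # r) (\<lambda>ys. L x y * \<gamma> (y # ys))"
    by simp
  also have "coboundary (z # r) (\<lambda>ys. L x y * \<gamma> (y # ys)) = L x y * \<gamma> (z # r)"
    using assms by (subst coboundary_mult_left) simp
  finally show ?thesis by (simp add: algebra_simps)
qed

lemma lift_diff_map:
  assumes "[s (g x) = s x + 1] (mod m)" "[s (g y) = s y + 1] (mod m)"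
  shows "lift_diff m s (g x) (g y) = lift_diff m s x y"
proof -
  have "[s (g y) - s (g x) + 1 = (s y + 1) - (s x + 1) + 1] (mod m)"
    by (intro cong_add cong_diff assms cong_refl)
  thus ?thesis by (simp add: lift_diff_def cong_def)
qed

lemma euler_power_map:
  assumes "\<And>i x. i < k \<Longrightarrow> x \<in> A \<Longrightarrow> [s i (g x) = s i x + 1] (mod m)"
  shows "set xs \<subseteq> A \<Longrightarrow> euler_power m s k (map g xs) = euler_power m s k xs"
  using assms
proof (induction m s k xs rule: euler_power.induct)
  case (2 m s k x y z r)
  have "bockstein m (s k) (g x) (g y) (g z) = bockstein m (s k) x y z"
    unfolding bockstein_def using 2 by (simp add: lift_diff_map)
  with 2 show ?case by simp
qed auto

text \<open>
  If the labels differ from \<open>t\<close> by \<open>0\<close> or \<open>1\<close>, the lifted differences are the genuine differences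
  of an integer function, and these have coboundary zero.
\<close>

lemma bockstein_eq_0:
  assumes "m \<ge> 3"
    and "\<And>u. u \<in> {x, y, z} \<Longrightarrow> [s u = t] (mod m) \<or> [s u = t + 1] (mod m)"
  shows "bockstein m s x y z = 0"
proof -
  define e :: "'a \<Rightarrow> int" where "e = (\<lambda>u. if [s u = t] (mod m) then 0 else 1)"
  have e01: "0 \<le> e u" "e u \<le> 1" for u
    by (simp_all add: e_def)
  have e: "[s u = t + e u] (mod m)" if "u \<in> {x, y, z}" for u
    using assms(2)[OF that] by (auto simp: e_def)
  have "lift_diff m s u v = e v - e u" if "u \<in> {x, y, z}" "v \<in> {x, y, z}" for u v
  proof -
    have "[s v - s u + 1 = (t + e v) - (t + e u) + 1] (mod m)"
      by (rule cong_add[OF cong_diff[OF e[OF that(2)] e[OF that(1)]] cong_refl])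
    hence "(s v - s u + 1) mod m = (e v - e u + 1) mod m" by (simp add: cong_def)
    also have "\<dots> = e v - e u + 1"
      using e01[of u] e01[of v] assms(1) by (intro mod_pos_pos_trivial) linarith+
    finally show ?thesis by (simp add: lift_diff_def)
  qed
  thus ?thesis by (simp add: bockstein_def)
qed

lemma euler_power_eq_0:
  assumes "m \<ge> 3" "i < k"
    and "\<And>u. u \<in> set xs \<Longrightarrow> [s i u = t] (mod m) \<or> [s i u = t + 1] (mod m)"
  shows "euler_power m s k xs = 0"
  using assms
proof (induction m s k xs rule: euler_power.induct)
  case (2 m s k x y z r)
  show ?case
  proof (cases "i = k")
    case True
    have "bockstein m (s k) x y z = 0"
      by (rule bockstein_eq_0[OF \<open>m \<ge> 3\<close>, of x y z "s k" t]) (use 2(4) True in auto)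
    thus ?thesis by simp
  next
    case False
    have "euler_power m s k (z # r) = 0"
    proof (rule 2(1)[OF \<open>m \<ge> 3\<close>])
      show "i < k" using 2(3) False by simp
      show "[s i u = t] (mod m) \<or> [s i u = t + 1] (mod m)" if "u \<in> set (z # r)" for u
        by (rule 2(4)) (use that in auto)
    qed
    thus ?thesis by simp
  qed
next
  case (1 m s xs)
  from \<open>i < 0\<close> show ?case by simp
qed (simp_all (no_asm))

section \<open>Chains built from a periodic map\<close>

lemma cycle_imp_boundary:
  assumes "trivial_group (homology_group (int i) X)"
    and "singular_chain i X c" "chain_boundary i c = 0"
  obtains d where "singular_chain (Suc i) X d" "chain_boundary (Suc i) d = c"
proof -
  have c: "singular_relcycle i X {} c" using assms by (simp add: singular_cycle)
  hence "homologous_rel_set i X {} c \<in> carrier (homology_group (int i) X)"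
    by (simp add: carrier_relative_homology_group)
  hence "homologous_rel_set i X {} c = singular_relboundary_set i X {}"
    using assms(1) by (simp add: trivial_group_def)
  hence "singular_relboundary i X {} c"
    by (simp add: homologous_rel_set_eq_relboundary)
  thus ?thesis using that by (auto simp: singular_boundary)
qed

lemma singular_chain_subdivision_power:
  "singular_chain p X c \<Longrightarrow> singular_chain p X ((singular_subdivision p ^^ n) c)"
  by (induction n) (simp_all add: singular_chain_singular_subdivision)

lemma chain_map_subdivision_power:
  "singular_chain p X c \<Longrightarrow>
     (singular_subdivision p ^^ n) (chain_map p g c) = chain_map p g ((singular_subdivision p ^^ n) c)"
  by (induction n)
     (simp_all add: naturality_singular_subdivision[OF singular_chain_subdivision_power])

lemma chain_boundary_subdivision_power:
  "singular_chain (Suc p) X c \<Longrightarrow>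
     chain_boundary (Suc p) ((singular_subdivision (Suc p) ^^ n) c)
       = (singular_subdivision p ^^ n) (chain_boundary (Suc p) c)"
  by (induction n)
     (simp_all add: chain_boundary_singular_subdivision[OF singular_chain_subdivision_power])

lemma subdivision_power_sum:
  "(singular_subdivision p ^^ n) (\<Sum>i\<in>I. c i) = (\<Sum>i\<in>I. (singular_subdivision p ^^ n) (c i))"
proof (induction I rule: infinite_finite_induct)
  case (insert i I)
  have "(singular_subdivision p ^^ n) (a + b) =
     (singular_subdivision p ^^ n) a + (singular_subdivision p ^^ n) b" for a b :: "'a chain"
    by (induction n) (simp_all add: singular_subdivision_add)
  with insert show ?case by simp
qed simp_all

text \<open>
  For a periodic map this is the norm element of the cyclic group acting on chains.
\<close>

definition orbit_sum :: "nat \<Rightarrow> nat \<Rightarrow> ('a \<Rightarrow> 'a) \<Rightarrow> 'a chain \<Rightarrow> 'a chain" where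
  "orbit_sum m p g c = (\<Sum>j<m. chain_map p (g ^^ j) c)"

lemma continuous_map_funpow: "continuous_map X X g \<Longrightarrow> continuous_map X X (g ^^ j)"
  by (induction j) (simp_all add: continuous_map_compose)

lemma orbit_sum_funpow_eq:
  assumes "\<And>x. x \<in> topspace X \<Longrightarrow> (g ^^ m) x = x" "singular_chain p X c"
  shows "(\<Sum>j<m. chain_map p (g ^^ Suc j) c) = orbit_sum m p g c"
proof -
  have "(\<Sum>j<m. chain_map p (g ^^ Suc j) c) + chain_map p (g ^^ 0) c
        = (\<Sum>j<m. chain_map p (g ^^ j) c) + chain_map p (g ^^ m) c"
    using sum.lessThan_Suc_shift[of "\<lambda>j. chain_map p (g ^^ j) c" m]
    by (simp only: sum.lessThan_Suc add.commute)
  moreover have "chain_map p (g ^^ m) c = chain_map p (g ^^ 0) c"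
    by (rule chain_map_eq[OF assms(2)]) (simp add: assms(1))
  ultimately show ?thesis by (simp add: orbit_sum_def)
qed

lemma chain_map_orbit_sum:
  assumes "\<And>x. x \<in> topspace X \<Longrightarrow> (g ^^ m) x = x" "singular_chain p X c"
  shows "chain_map p g (orbit_sum m p g c) = orbit_sum m p g c"
proof -
  have "chain_map p g (chain_map p (g ^^ j) c) = chain_map p (g ^^ Suc j) c" for j
    using chain_map_compose[of p g "g ^^ j"] by (simp add: o_def fun_eq_iff)
  thus ?thesis
    using orbit_sum_funpow_eq[OF assms] by (simp add: orbit_sum_def chain_map_sum o_def)
qed

lemma orbit_sum_chain_map:
  assumes "\<And>x. x \<in> topspace X \<Longrightarrow> (g ^^ m) x = x" "singular_chain p X c"
  shows "orbit_sum m p g (chain_map p g c) = orbit_sum m p g c"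
proof -
  have "chain_map p (g ^^ j) (chain_map p g c) = chain_map p (g ^^ Suc j) c" for j
    unfolding funpow_Suc_right chain_map_compose by simp
  thus ?thesis
    using orbit_sum_funpow_eq[OF assms] by (simp add: orbit_sum_def)
qed

lemma singular_chain_orbit_sum:
  "continuous_map X X g \<Longrightarrow> singular_chain p X c \<Longrightarrow> singular_chain p X (orbit_sum m p g c)"
  unfolding orbit_sum_def
  by (intro singular_chain_sum singular_chain_chain_map[of _ X]) (auto intro: continuous_map_funpow)

lemma chain_boundary_orbit_sum:
  assumes "singular_chain (Suc p) X c"
  shows "chain_boundary (Suc p) (orbit_sum m (Suc p) g c) = orbit_sum m p g (chain_boundary (Suc p) c)"
  unfolding orbit_sum_def chain_boundary_sum
  by (simp add: o_def chain_boundary_chain_map[OF assms])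

lemma orbit_sum_diff: "orbit_sum m p g (a - b) = orbit_sum m p g a - orbit_sum m p g b"
  by (simp add: orbit_sum_def chain_map_diff sum_subtractf)

lemma subdivision_power_orbit_sum:
  "singular_chain p X c \<Longrightarrow>
     (singular_subdivision p ^^ n) (orbit_sum m p g c) = orbit_sum m p g ((singular_subdivision p ^^ n) c)"
  by (simp add: orbit_sum_def subdivision_power_sum chain_map_subdivision_power)

lemma evaluate_orbit_sum:
  assumes "singular_chain p X c" "continuous_map X X g"
    and "\<And>xs. length xs = Suc p \<Longrightarrow> set xs \<subseteq> topspace X \<Longrightarrow> f (map g xs) = f xs"
  shows "evaluate f p (orbit_sum m p g c) = int m * evaluate f p c"
proof -
  have "f (map (g ^^ j) xs) = f xs" if "length xs = Suc p" "set xs \<subseteq> topspace X" for j xs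
  proof (induction j)
    case (Suc j)
    have "(g ^^ j) x \<in> topspace X" if "x \<in> topspace X" for x
      using continuous_map_funpow[OF assms(2), of j] that by (auto simp: continuous_map_def)
    hence "set (map (g ^^ j) xs) \<subseteq> topspace X" using that by auto
    hence "f (map g (map (g ^^ j) xs)) = f (map (g ^^ j) xs)"
      by (intro assms(3)) (use that in auto)
    with Suc show ?case by (simp add: o_def)
  qed simp
  hence "evaluate f p (chain_map p (g ^^ j) c) = evaluate f p c" for j
    unfolding evaluate_chain_map by (intro evaluate_cong[OF assms(1)])
  thus ?thesis by (simp add: orbit_sum_def evaluate_sum)
qed

text \<open>
  One period of the standard resolution of a cyclic group. Since \<open>m\<close> times the Bockstein is the
  coboundary of the lifted differences \<open>L\<close>, and \<open>L\<close> is invariant, the boundary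
  \<open>orbit_sum m _ g a\<close> of \<open>b\<close> contributes \<open>m\<close> times the value on \<open>a\<close>, and \<open>m\<close> cancels. Modulo \<open>m\<close>
  the cochain \<open>L\<close> is the coboundary of the labelling, and the labelling increases by \<open>1\<close> under
  \<open>g\<close>, so the boundary \<open>g c - c\<close> of \<open>a\<close> contributes the value on \<open>c\<close>.
\<close>

lemma euler_chain_step:
  fixes X :: "'a topology" and s :: "nat \<Rightarrow> 'a \<Rightarrow> int" and m :: nat
  assumes m: "m \<noteq> 0" and g: "continuous_map X X g"
    and eqv: "\<And>i x. i \<le> k \<Longrightarrow> x \<in> topspace X \<Longrightarrow> [s i (g x) = s i x + 1] (mod int m)"
    and c: "singular_chain (2 * k) X c" and a: "singular_chain (Suc (2 * k)) X a"
    and b: "singular_chain (Suc (Suc (2 * k))) X b"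
    and da: "chain_boundary (Suc (2 * k)) a = chain_map (2 * k) g c - c"
    and db: "chain_boundary (Suc (Suc (2 * k))) b = orbit_sum m (Suc (2 * k)) g a"
  shows "[evaluate (euler_power (int m) s (Suc k)) (Suc (Suc (2 * k))) b
            = evaluate (euler_power (int m) s k) (2 * k) c] (mod int m)"
proof -
  define \<gamma> where "\<gamma> = euler_power (int m) s k"
  define L where "L = cup_edge (lift_diff (int m) (s k)) \<gamma>"
  define S where "S = cup_label (s k) \<gamma>"
  have \<gamma>_map: "\<gamma> (map g xs) = \<gamma> xs" if "set xs \<subseteq> topspace X" for xs
    unfolding \<gamma>_def by (rule euler_power_map[where A = "topspace X"]) (use eqv that in auto)
  have d\<gamma>: "coboundary xs \<gamma> = 0" if "length xs = 2 * k + 2" for xs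
    unfolding \<gamma>_def by (rule coboundary_euler_power) (use m that in auto)
  have L_map: "L (map g xs) = L xs" if "set xs \<subseteq> topspace X" for xs
  proof (cases "(lift_diff (int m) (s k), \<gamma>, xs)" rule: cup_edge.cases)
    case (1 L' \<gamma>' x y r)
    hence xs: "xs = x # y # r" by simp
    have "lift_diff (int m) (s k) (g x) (g y) = lift_diff (int m) (s k) x y"
      by (intro lift_diff_map eqv) (use that xs in auto)
    thus ?thesis using \<gamma>_map[of "y # r"] that by (simp add: L_def xs)
  qed (auto simp: L_def)
  \<comment> \<open>From \<open>b\<close> to \<open>a\<close>: an equality of integers.\<close>
  have "int m * evaluate (euler_power (int m) s (Suc k)) (Suc (Suc (2 * k))) b
      = evaluate (\<lambda>xs. coboundary xs L) (Suc (Suc (2 * k))) b"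
    unfolding evaluate_mult_left[symmetric]
  proof (rule evaluate_cong[OF b])
    fix xs :: "'a list" assume "length xs = Suc (Suc (Suc (2 * k)))"
    then obtain x y z r where xs: "xs = x # y # z # r" "length r = 2 * k"
      by (auto simp: length_Suc_conv)
    have "coboundary (y # z # r) \<gamma> = 0" by (rule d\<gamma>) (use xs in simp)
    hence "coboundary xs L = (int m * bockstein (int m) (s k) x y z) * \<gamma> (z # r)"
      unfolding xs L_def by (subst coboundary_cup_edge) (simp_all add: mult_bockstein)
    thus "int m * euler_power (int m) s (Suc k) xs = coboundary xs L"
      by (simp add: xs \<gamma>_def)
  qed
  also have "\<dots> = int m * evaluate L (Suc (2 * k)) a"
    unfolding evaluate_chain_boundary[symmetric] db
    by (rule evaluate_orbit_sum[OF a g]) (use L_map in auto)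
  finally have 1: "evaluate (euler_power (int m) s (Suc k)) (Suc (Suc (2 * k))) b
                   = evaluate L (Suc (2 * k)) a"
    using m by simp
  \<comment> \<open>From \<open>a\<close> to \<open>c\<close>: only a congruence, because \<open>L\<close> is a coboundary modulo \<open>m\<close> only.\<close>
  have "[evaluate L (Suc (2 * k)) a = evaluate (\<lambda>xs. coboundary xs S) (Suc (2 * k)) a] (mod int m)"
  proof (rule evaluate_cong_mod[OF a])
    fix xs :: "'a list" assume "length xs = Suc (Suc (2 * k))"
    then obtain x y r where xs: "xs = x # y # r" "length r = 2 * k"
      by (auto simp: length_Suc_conv)
    have "coboundary xs S = (s k y - s k x) * \<gamma> (y # r)"
      unfolding xs S_def by (rule coboundary_cup_label[OF d\<gamma>]) (use xs in simp)
    thus "[L xs = coboundary xs S] (mod int m)"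
      by (simp add: L_def xs cong_mult cong_lift_diff)
  qed
  also have "evaluate (\<lambda>xs. coboundary xs S) (Suc (2 * k)) a
      = evaluate (\<lambda>xs. S (map g xs)) (2 * k) c - evaluate S (2 * k) c"
    by (simp only: evaluate_chain_boundary[symmetric] da evaluate_diff evaluate_chain_map)
  also have "[evaluate (\<lambda>xs. S (map g xs)) (2 * k) c - evaluate S (2 * k) c
      = evaluate (\<lambda>xs. S xs + \<gamma> xs) (2 * k) c - evaluate S (2 * k) c] (mod int m)"
  proof (intro cong_diff cong_refl evaluate_cong_mod[OF c])
    fix xs :: "'a list" assume "length xs = Suc (2 * k)" and X: "set xs \<subseteq> topspace X"
    then obtain x r where xs: "xs = x # r" by (auto simp: length_Suc_conv)
    have "[s k (g x) * \<gamma> (map g xs) = (s k x + 1) * \<gamma> xs] (mod int m)"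
      using X by (intro cong_mult eqv) (auto simp: xs \<gamma>_map[OF X, unfolded xs, simplified])
    thus "[S (map g xs) = S xs + \<gamma> xs] (mod int m)"
      by (simp add: S_def xs algebra_simps)
  qed
  also have "evaluate (\<lambda>xs. S xs + \<gamma> xs) (2 * k) c - evaluate S (2 * k) c = evaluate \<gamma> (2 * k) c"
    by (simp add: evaluate_add_left)
  finally show ?thesis unfolding 1 \<gamma>_def .
qed

text \<open>
  Acyclicity allows to solve, alternately, \<open>\<partial> a = g c - c\<close> and \<open>\<partial> b = orbit_sum m _ g a\<close>. The
  invariance of the boundary of \<open>c\<close> is what makes \<open>g c - c\<close> a cycle. The value is controlled on all
  iterated subdivisions at once, because the fineness that will be needed depends on the chain, and
  subdivision commutes with the boundary and with \<open>g\<close>. For \<open>k = 0\<close> the chain is a single point, and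
  a path from this point to its image replaces the first use of acyclicity.
\<close>

lemma exists_euler_chain:
  fixes X :: "'a topology" and s :: "nat \<Rightarrow> 'a \<Rightarrow> int" and m :: nat
  assumes m: "m \<noteq> 0" and g: "continuous_map X X g"
    and gm: "\<And>x. x \<in> topspace X \<Longrightarrow> (g ^^ m) x = x"
    and X: "path_connected_space X" "topspace X \<noteq> {}"
    and hom: "\<And>i. 0 < i \<Longrightarrow> i < 2 * k \<Longrightarrow> trivial_group (homology_group (int i) X)"
    and eqv: "\<And>i x. i < k \<Longrightarrow> x \<in> topspace X \<Longrightarrow> [s i (g x) = s i x + 1] (mod int m)"
  shows "\<exists>c. singular_chain (2 * k) X c \<and>
           (k = 0 \<longrightarrow> (\<exists>\<sigma>. c = frag_of \<sigma>)) \<and>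
           chain_map (2 * k - 1) g (chain_boundary (2 * k) c) = chain_boundary (2 * k) c \<and>
           (\<forall>n. [evaluate (euler_power (int m) s k) (2 * k) ((singular_subdivision (2 * k) ^^ n) c) = 1]
              (mod int m))"
  using hom eqv
proof (induction k)
  case 0
  obtain x where x: "x \<in> topspace X" using X(2) by blast
  define c where "c = frag_of (restrict (\<lambda>_. x) (standard_simplex 0) :: (nat \<Rightarrow> real) \<Rightarrow> 'a)"
  have c: "singular_chain 0 X c"
    unfolding c_def singular_chain_of using x by (simp add: singular_simplex_def)
  have "(singular_subdivision 0 ^^ n) c = c" for n
    by (induction n) (simp_all add: singular_subdivision_zero[OF c])
  hence "\<forall>n. [evaluate (euler_power (int m) s 0) 0 ((singular_subdivision 0 ^^ n) c) = 1] (mod int m)"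
    by (simp add: c_def)
  moreover have "\<exists>\<sigma>. c = frag_of \<sigma>" by (auto simp: c_def)
  ultimately show ?case
    using c by (intro exI[of _ c]) (simp add: chain_boundary_def del: euler_power.simps)
next
  case (Suc k)
  have "\<exists>c. singular_chain (2 * k) X c \<and>
           (k = 0 \<longrightarrow> (\<exists>\<sigma>. c = frag_of \<sigma>)) \<and>
           chain_map (2 * k - 1) g (chain_boundary (2 * k) c) = chain_boundary (2 * k) c \<and>
           (\<forall>n. [evaluate (euler_power (int m) s k) (2 * k) ((singular_subdivision (2 * k) ^^ n) c) = 1]
              (mod int m))"
    by (rule Suc.IH) (use Suc.prems in auto)
  then obtain c where c: "singular_chain (2 * k) X c"
    and c0: "k = 0 \<longrightarrow> (\<exists>\<sigma>. c = frag_of \<sigma>)"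
    and dc: "chain_map (2 * k - 1) g (chain_boundary (2 * k) c) = chain_boundary (2 * k) c"
    and val: "\<And>n. [evaluate (euler_power (int m) s k) (2 * k) ((singular_subdivision (2 * k) ^^ n) c) = 1]
              (mod int m)"
    by blast
  have gc: "singular_chain (2 * k) X (chain_map (2 * k) g c)"
    using singular_chain_chain_map[OF c g] .
  obtain a where a: "singular_chain (Suc (2 * k)) X a"
    and da: "chain_boundary (Suc (2 * k)) a = chain_map (2 * k) g c - c"
  proof (cases "k = 0")
    case True
    then obtain \<sigma> where \<sigma>: "c = frag_of \<sigma>" using c0 by blast
    have "homologous_rel 0 X {} (chain_map 0 g c) c"
      using c gc True unfolding \<sigma>
      by (simp add: singular_chain_of iso_integer_zeroth_homology_group_aux[OF X(1)])
    thus ?thesis using that True by (auto simp: homologous_rel_def singular_boundary)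
  next
    case False
    have "chain_boundary (2 * k) (chain_map (2 * k) g c - c) = 0"
      using dc by (simp add: chain_boundary_diff chain_boundary_chain_map[OF c])
    moreover have "trivial_group (homology_group (int (2 * k)) X)"
      using False by (intro Suc.prems) auto
    ultimately show ?thesis
      using cycle_imp_boundary that singular_chain_diff[OF gc c] by metis
  qed
  let ?N = "orbit_sum m (Suc (2 * k)) g a"
  have N: "singular_chain (Suc (2 * k)) X ?N" using singular_chain_orbit_sum[OF g a] .
  have "chain_boundary (Suc (2 * k)) ?N = 0"
    by (simp add: chain_boundary_orbit_sum[OF a] da orbit_sum_diff orbit_sum_chain_map[OF gm c])
  moreover have "trivial_group (homology_group (int (Suc (2 * k))) X)"
    by (intro Suc.prems) auto
  ultimately obtain b where b: "singular_chain (Suc (Suc (2 * k))) X b"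
    and db: "chain_boundary (Suc (Suc (2 * k))) b = ?N"
    using cycle_imp_boundary N by metis
  have "[evaluate (euler_power (int m) s (Suc k)) (Suc (Suc (2 * k)))
           ((singular_subdivision (Suc (Suc (2 * k))) ^^ n) b) = 1] (mod int m)" for n
  proof -
    have "[evaluate (euler_power (int m) s (Suc k)) (Suc (Suc (2 * k)))
             ((singular_subdivision (Suc (Suc (2 * k))) ^^ n) b)
           = evaluate (euler_power (int m) s k) (2 * k) ((singular_subdivision (2 * k) ^^ n) c)] (mod int m)"
    proof (rule euler_chain_step[OF m g])
      show "[s i (g x) = s i x + 1] (mod int m)" if "i \<le> k" "x \<in> topspace X" for i x
        using that by (intro Suc.prems) auto
      show "chain_boundary (Suc (2 * k)) ((singular_subdivision (Suc (2 * k)) ^^ n) a) =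
        chain_map (2 * k) g ((singular_subdivision (2 * k) ^^ n) c) - (singular_subdivision (2 * k) ^^ n) c"
        by (simp add: chain_boundary_subdivision_power[OF a] da singular_subdivision_power_diff
              chain_map_subdivision_power[OF c])
      show "chain_boundary (Suc (Suc (2 * k))) ((singular_subdivision (Suc (Suc (2 * k))) ^^ n) b) =
        orbit_sum m (Suc (2 * k)) g ((singular_subdivision (Suc (2 * k)) ^^ n) a)"
        by (simp add: chain_boundary_subdivision_power[OF b] db subdivision_power_orbit_sum[OF a])
    qed (intro singular_chain_subdivision_power a b c)+
    from cong_trans[OF this val] show ?thesis .
  qed
  moreover have "chain_map (Suc (2 * k)) g (chain_boundary (Suc (Suc (2 * k))) b)
               = chain_boundary (Suc (Suc (2 * k))) b"
    unfolding db by (rule chain_map_orbit_sum[OF gm a])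
  ultimately show ?case using b by (intro exI[of _ b]) simp
qed

section \<open>Common zeros of equivariant maps\<close>

text \<open>
  Another choice of the argument of \<open>w\<close> changes the real number inside the floor by an integer
  multiple of \<open>m\<close>.
\<close>

lemma floor_Arg2pi_cong:
  assumes "w = complex_of_real r * cis \<tau>" "r > 0"
  shows "[\<lfloor>real m * Arg2pi w / (2 * pi)\<rfloor> = \<lfloor>real m * \<tau> / (2 * pi)\<rfloor>] (mod int m)"
proof -
  have "w = complex_of_real (norm w) * exp (\<i> * complex_of_real (Arg2pi w))"
    using Arg2pi_eq[of w] by simp
  moreover have "norm w = r" using assms by (simp add: norm_mult)
  ultimately have "complex_of_real r * cis \<tau> = complex_of_real r * cis (Arg2pi w)"
    using assms by (simp add: cis_conv_exp)
  hence "cis \<tau> = cis (Arg2pi w)" using assms by simp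
  then obtain k :: int where "\<i> * complex_of_real \<tau> = \<i> * complex_of_real (Arg2pi w) + (of_int (2 * k) * pi) * \<i>"
    unfolding cis_conv_exp exp_eq by auto
  hence "Im (\<i> * complex_of_real \<tau>) = Im (\<i> * complex_of_real (Arg2pi w) + (of_int (2 * k) * pi) * \<i>)"
    by simp
  hence \<tau>: "\<tau> = Arg2pi w + 2 * pi * of_int k" by simp
  have "real m * \<tau> / (2 * pi) = real m * Arg2pi w / (2 * pi) + of_int (int m * k)"
    unfolding \<tau> by (simp add: field_simps)
  hence "\<lfloor>real m * \<tau> / (2 * pi)\<rfloor> = \<lfloor>real m * Arg2pi w / (2 * pi)\<rfloor> + int m * k"
    by (simp only: floor_add_int)
  thus ?thesis by (simp add: cong_iff_dvd_diff)
qed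

text \<open>
  The label of \<open>w\<close> is the index of the sector of angle \<open>2 \<pi> / m\<close> containing \<open>w\<close>. A rotation by
  this angle increases it by one, and a neighbourhood of \<open>w\<close> of angular radius \<open>\<pi> / m\<close> meets at
  most two neighbouring sectors.
\<close>

lemma sector_label:
  fixes m :: nat
  assumes "m \<ge> 1"
  obtains S :: "complex \<Rightarrow> int" where
    "\<And>w. w \<noteq> 0 \<Longrightarrow> [S (cis (2 * pi / m) * w) = S w + 1] (mod int m)"
    "\<And>w. w \<noteq> 0 \<Longrightarrow> \<exists>V t. open V \<and> w \<in> V \<and> 0 \<notin> V \<and> (\<forall>u\<in>V. [S u = t] (mod int m) \<or> [S u = t + 1] (mod int m))"
proof
  define S where "S w = \<lfloor>real m * Arg2pi w / (2 * pi)\<rfloor>" for w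
  show "[S (cis (2 * pi / m) * w) = S w + 1] (mod int m)" if "w \<noteq> 0" for w
  proof -
    have w: "w = complex_of_real (norm w) * cis (Arg2pi w)"
      using Arg2pi_eq[of w] by (simp add: cis_conv_exp)
    have eq: "cis (2 * pi / m) * w = complex_of_real (norm w) * cis (Arg2pi w + 2 * pi / m)"
      by (subst (1) w) (simp add: cis_mult[symmetric])
    have "[S (cis (2 * pi / m) * w) = \<lfloor>real m * (Arg2pi w + 2 * pi / m) / (2 * pi)\<rfloor>] (mod int m)"
      unfolding S_def by (rule floor_Arg2pi_cong[OF eq]) (use that in simp)
    also have "real m * (Arg2pi w + 2 * pi / m) / (2 * pi) = real m * Arg2pi w / (2 * pi) + 1"
      using assms by (simp add: field_simps)
    finally show ?thesis by (simp add: S_def)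
  qed
  show "\<exists>V t. open V \<and> w \<in> V \<and> 0 \<notin> V \<and> (\<forall>u\<in>V. [S u = t] (mod int m) \<or> [S u = t + 1] (mod int m))" 
    if "w \<noteq> 0" for w
  proof -
    have "w / w \<notin> \<real>\<^sub>\<le>\<^sub>0" using that by simp
    hence "isCont Arg (w / w)" by (rule continuous_at_Arg)
    moreover have "isCont (\<lambda>u. u / w) w" using that by (intro continuous_intros)
    ultimately have "isCont (\<lambda>u. Arg (u / w)) w" by (rule isCont_o2[rotated])
    hence "((\<lambda>u. Arg (u / w)) \<longlongrightarrow> Arg (w / w)) (nhds w)"
      unfolding isCont_def by (rule tendsto_at_iff_tendsto_nhds[of "\<lambda>u. Arg (u / w)", THEN iffD1])
    hence "((\<lambda>u. Arg (u / w)) \<longlongrightarrow> 0) (nhds w)" using that by simp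
    hence "\<forall>\<^sub>F u in nhds w. dist (Arg (u / w)) 0 < pi / m"
      by (rule tendstoD) (use assms in simp)
    moreover have "\<forall>\<^sub>F u in nhds w. u \<noteq> 0"
      by (rule t1_space_nhds[OF that])
    ultimately have "\<forall>\<^sub>F u in nhds w. dist (Arg (u / w)) 0 < pi / m \<and> u \<noteq> 0"
      by (rule eventually_conj)
    then obtain V where V: "open V" "w \<in> V" "\<And>u. u \<in> V \<Longrightarrow> \<bar>Arg (u / w)\<bar> < pi / m \<and> u \<noteq> 0"
      unfolding eventually_nhds by auto
    define y where "y = real m * Arg2pi w / (2 * pi)"
    have "[S u = \<lfloor>y - 1/2\<rfloor>] (mod int m) \<or> [S u = \<lfloor>y - 1/2\<rfloor> + 1] (mod int m)" if "u \<in> V" for u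
    proof -
      define \<alpha> where "\<alpha> = Arg (u / w)"
      have \<alpha>: "\<bar>\<alpha>\<bar> < pi / m" and "u \<noteq> 0" using V(3)[OF that] by (auto simp: \<alpha>_def)
      have w: "w = complex_of_real (norm w) * cis (Arg2pi w)"
        using Arg2pi_eq[of w] by (simp add: cis_conv_exp)
      have "u / w = complex_of_real (norm (u / w)) * cis \<alpha>"
        using Arg_eq[of "u / w"] \<open>u \<noteq> 0\<close> \<open>w \<noteq> 0\<close> by (simp add: cis_conv_exp \<alpha>_def)
      hence "u = (complex_of_real (norm (u / w)) * cis \<alpha>) * (complex_of_real (norm w) * cis (Arg2pi w))"
        using w \<open>w \<noteq> 0\<close> by (metis nonzero_divide_eq_eq)
      hence "u = complex_of_real (norm (u / w) * norm w) * cis (Arg2pi w + \<alpha>)"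
        by (simp add: cis_mult[symmetric] mult_ac)
      hence "[S u = \<lfloor>real m * (Arg2pi w + \<alpha>) / (2 * pi)\<rfloor>] (mod int m)"
        unfolding S_def by (rule floor_Arg2pi_cong) (use \<open>u \<noteq> 0\<close> \<open>w \<noteq> 0\<close> in simp)
      moreover have "real m * (Arg2pi w + \<alpha>) / (2 * pi) = y + real m * \<alpha> / (2 * pi)"
        by (simp add: y_def field_simps)
      moreover have "\<bar>real m * \<alpha> / (2 * pi)\<bar> < 1 / 2"
        using \<alpha> assms by (simp add: abs_mult field_simps)
      hence "\<lfloor>y + real m * \<alpha> / (2 * pi)\<rfloor> = \<lfloor>y - 1/2\<rfloor> \<or> \<lfloor>y + real m * \<alpha> / (2 * pi)\<rfloor> = \<lfloor>y - 1/2\<rfloor> + 1"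
        by linarith
      ultimately show ?thesis by metis
    qed
    thus ?thesis using V by blast
  qed
qed

text \<open>
  A Borsuk-Ulam theorem for maps that are periodic of period \<open>m\<close>. Without a common zero, the sets
  on which a nonzero \<open>G i\<close> stays in two adjacent sectors form an open cover of \<open>X\<close>, and the product
  of the Bockstein cocycles vanishes on all simplices subordinate to it.
\<close>

theorem equivariant_maps_common_zero:
  fixes X :: "'a topology" and G :: "nat \<Rightarrow> 'a \<Rightarrow> complex" and m :: nat
  assumes m: "m \<ge> 3" and g: "continuous_map X X g"
    and gm: "\<And>x. x \<in> topspace X \<Longrightarrow> (g ^^ m) x = x"
    and X: "path_connected_space X" "topspace X \<noteq> {}"
    and hom: "\<And>i. 0 < i \<Longrightarrow> i < 2 * M \<Longrightarrow> trivial_group (homology_group (int i) X)"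
    and G: "\<And>i. i < M \<Longrightarrow> continuous_map X euclidean (G i)"
    and eqv: "\<And>i x. i < M \<Longrightarrow> x \<in> topspace X \<Longrightarrow> G i (g x) = cis (2 * pi / m) * G i x"
  shows "\<exists>x\<in>topspace X. \<forall>i<M. G i x = 0"
proof (rule ccontr)
  assume "\<not> ?thesis"
  hence nz: "\<exists>i<M. G i x \<noteq> 0" if "x \<in> topspace X" for x using that by blast
  from m have "m \<ge> 1" by simp
  from sector_label[OF this] obtain S :: "complex \<Rightarrow> int" where
    S: "\<And>w. w \<noteq> 0 \<Longrightarrow> [S (cis (2 * pi / m) * w) = S w + 1] (mod int m)" and
    V: "\<And>w. w \<noteq> 0 \<Longrightarrow> \<exists>V t. open V \<and> w \<in> V \<and> 0 \<notin> V \<and> (\<forall>u\<in>V. [S u = t] (mod int m) \<or> [S u = t + 1] (mod int m))"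
    by blast
  define first where "first x = (LEAST l. l < M \<and> G l x \<noteq> 0)" for x
  \<comment> \<open>Where \<open>G i\<close> vanishes, its label is borrowed from another map, so that every labelling is defined
    on all of \<open>X\<close> and still increases by one under \<open>g\<close>.\<close>
  define lab where "lab i x = (if G i x \<noteq> 0 then S (G i x) else S (G (first x) x))" for i x
  have first: "first x < M \<and> G (first x) x \<noteq> 0" if "x \<in> topspace X" for x
    unfolding first_def using LeastI_ex[OF nz[OF that]] .
  have g_in: "g x \<in> topspace X" if "x \<in> topspace X" for x
    using g that by (auto simp: continuous_map_def)
  have "first (g x) = first x" if "x \<in> topspace X" for x
    unfolding first_def by (rule arg_cong[where f = Least]) (use eqv that in \<open>auto simp: fun_eq_iff\<close>)
  hence lab_eqv: "[lab i (g x) = lab i x + 1] (mod int m)" if "i < M" "x \<in> topspace X" for i x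
    using eqv[OF that] eqv[OF conjunct1[OF first[OF that(2)]] that(2)] first[OF that(2)] S that
    by (simp add: lab_def)
  define \<C> where "\<C> = {U. openin X U \<and>
     (\<exists>i<M. \<exists>t. \<forall>u\<in>U. [lab i u = t] (mod int m) \<or> [lab i u = t + 1] (mod int m))}"
  have cover: "topspace X \<subseteq> \<Union>\<C>"
  proof
    fix x assume x: "x \<in> topspace X"
    then obtain i where i: "i < M" "G i x \<noteq> 0" using nz by blast
    obtain V t where V: "open V" "G i x \<in> V" "0 \<notin> V"
      "\<And>u. u \<in> V \<Longrightarrow> [S u = t] (mod int m) \<or> [S u = t + 1] (mod int m)"
      using V[OF i(2)] by blast
    define U where "U = {u \<in> topspace X. G i u \<in> V}"
    have "openin X U"
      unfolding U_def by (rule openin_continuous_map_preimage[OF G[OF i(1)]]) (use V in simp)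
    moreover have "[lab i u = t] (mod int m) \<or> [lab i u = t + 1] (mod int m)" if "u \<in> U" for u
    proof -
      have "G i u \<in> V" using that by (simp add: U_def)
      moreover from this have "G i u \<noteq> 0" using V(3) by metis
      ultimately show ?thesis using V(4) by (simp add: lab_def)
    qed
    ultimately have "U \<in> \<C>" using i(1) by (auto simp: \<C>_def)
    moreover have "x \<in> U" using x V by (simp add: U_def)
    ultimately show "x \<in> \<Union>\<C>" by blast
  qed
  obtain c where c: "singular_chain (2 * M) X c"
    and val: "\<And>n. [evaluate (euler_power (int m) lab M) (2 * M) ((singular_subdivision (2 * M) ^^ n) c) = 1] (mod int m)"
  proof -
    have "m \<noteq> 0" using m by simp
    from exists_euler_chain[where k = M and s = lab, OF this g gm X hom lab_eqv]
    show ?thesis using that by blast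
  qed
  obtain n where n: "\<And>l f. \<lbrakk>n \<le> l; f \<in> Poly_Mapping.keys ((singular_subdivision (2 * M) ^^ l) c)\<rbrakk>
      \<Longrightarrow> \<exists>V\<in>\<C>. f \<in> standard_simplex (2 * M) \<rightarrow> V"
    using sufficient_iterated_singular_subdivision_exists[of \<C> X "2 * M" c] cover c
    unfolding \<C>_def by blast
  have "euler_power (int m) lab M (vertices (2 * M) \<sigma>) = 0"
    if \<sigma>: "\<sigma> \<in> Poly_Mapping.keys ((singular_subdivision (2 * M) ^^ n) c)" for \<sigma>
  proof -
    obtain U where U: "U \<in> \<C>" "\<sigma> \<in> standard_simplex (2 * M) \<rightarrow> U" using n[OF order_refl \<sigma>] by blast
    have "set (vertices (2 * M) \<sigma>) \<subseteq> U"
      using U(2) by (auto simp: vertices_def simp del: upt_Suc)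
    moreover obtain i t where "i < M" "\<And>u. u \<in> U \<Longrightarrow> [lab i u = t] (mod int m) \<or> [lab i u = t + 1] (mod int m)"
      using U(1) unfolding \<C>_def by blast
    ultimately show ?thesis
      using m by (intro euler_power_eq_0[of "int m" i M _ lab t]) auto
  qed
  hence "evaluate (euler_power (int m) lab M) (2 * M) ((singular_subdivision (2 * M) ^^ n) c) = 0"
    by (simp add: evaluate_def)
  with val[of n] have "[0 = 1] (mod int m)" by simp
  hence "int m dvd 1" unfolding cong_0_iff[symmetric] by (rule cong_sym)
  with m show False by simp
qed

definition csphere :: "nat \<Rightarrow> (nat \<Rightarrow> complex) set" where
  "csphere N = {a. (\<forall>i>N. a i = 0) \<and> (\<Sum>i\<le>N. (cmod (a i))\<^sup>2) = 1}"

definition to_complex :: "(nat \<Rightarrow> real) \<Rightarrow> nat \<Rightarrow> complex" where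
  "to_complex x i = of_real (x (2 * i)) + \<i> * of_real (x (2 * i + 1))"

definition rotate_coords :: "complex \<Rightarrow> (nat \<Rightarrow> real) \<Rightarrow> nat \<Rightarrow> real" where
  "rotate_coords c x l = (if even l then Re (c * to_complex x (l div 2)) else Im (c * to_complex x (l div 2)))"

lemma to_complex_rotate_coords: "to_complex (rotate_coords c x) = (\<lambda>i. c * to_complex x i)"
  unfolding to_complex_def[of "rotate_coords c x"]
  by (auto simp: rotate_coords_def fun_eq_iff complex_eq_iff)

lemma inj_to_complex: "inj to_complex"
proof (rule injI, rule ext)
  fix x y l assume eq: "to_complex x = to_complex y"
  have "Re (to_complex x (l div 2)) = Re (to_complex y (l div 2))"
       "Im (to_complex x (l div 2)) = Im (to_complex y (l div 2))" by (simp_all add: eq)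
  thus "x l = y l" by (cases "even l") (auto simp: to_complex_def elim!: evenE oddE)
qed

lemma topspace_nsphere_odd_iff: "x \<in> topspace (nsphere (2 * N + 1)) \<longleftrightarrow> to_complex x \<in> csphere N"
proof -
  have "(\<Sum>i\<le>2 * N + 1. (x i)\<^sup>2) = (\<Sum>i\<le>N. (cmod (to_complex x i))\<^sup>2)"
    by (induction N) (simp_all add: to_complex_def cmod_power2)
  moreover have "(\<forall>i>2 * N + 1. x i = 0) \<longleftrightarrow> (\<forall>i>N. to_complex x i = 0)"
  proof safe
    fix i assume "\<forall>i>N. to_complex x i = 0" "i > 2 * N + 1"
    moreover from this have "i div 2 > N" by auto
    ultimately have "to_complex x (i div 2) = 0" by blast
    thus "x i = 0" by (cases "even i") (auto simp: to_complex_def complex_eq_iff elim!: evenE oddE)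
  qed (auto simp: to_complex_def)
  ultimately show ?thesis by (simp add: nsphere csphere_def conj_commute)
qed

lemma nsphere_eq_top_of_set: "nsphere n = top_of_set (topspace (nsphere n))"
  by (simp add: nsphere euclidean_product_topology)

lemma continuous_on_to_complex: "continuous_on A to_complex"
  unfolding to_complex_def
  by (intro continuous_on_coordinatewise_then_product continuous_intros
       continuous_on_product_then_coordinatewise[OF continuous_on_id])

text \<open>
  Two closed hemispheres are contractible and share a point of the equator.
\<close>

lemma path_connected_space_nsphere:
  assumes "n \<ge> 1"
  shows "path_connected_space (nsphere n)"
proof -
  define A where "A = topspace (nsphere n) \<inter> {x. x 0 \<ge> 0}"
  define B where "B = topspace (nsphere n) \<inter> {x. x 0 \<le> 0}"
  have "path_connectedin (nsphere n) A" "path_connectedin (nsphere n) B"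
    unfolding A_def B_def path_connectedin_def subtopology_restrict
    by (simp_all add: contractible_imp_path_connected_space
          contractible_space_upper_hemisphere contractible_space_lower_hemisphere)
  moreover have "(\<lambda>i. if i = 1 then 1 else 0) \<in> A \<inter> B"
    using assms by (simp add: A_def B_def nsphere if_distrib[of "\<lambda>x. x ^ 2"] cong: if_cong)
  ultimately have "path_connectedin (nsphere n) (A \<union> B)"
    by (intro path_connectedin_Un) auto
  moreover have "A \<union> B = topspace (nsphere n)" by (auto simp: A_def B_def)
  ultimately show ?thesis by (simp add: path_connectedin_topspace)
qed

text \<open>
  The prime \<open>m\<close> exceeds all weights, so each weight has an inverse \<open>e i\<close> modulo \<open>m\<close>, and the
  \<open>e i\<close>-th power of \<open>F i\<close> has the same zeros and weight \<open>1\<close> under the rotation by \<open>2 \<pi> / m\<close>. The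
  sphere of real dimension \<open>2 N + 1\<close> has no homology in the degrees \<open>1, \<dots>, 2 N - 1\<close>.
\<close>

theorem circle_equivariant_maps_common_zero:
  fixes F :: "nat \<Rightarrow> (nat \<Rightarrow> complex) \<Rightarrow> complex" and k :: "nat \<Rightarrow> nat"
  assumes cont: "\<And>i. i < N \<Longrightarrow> continuous_on (csphere N) (F i)"
    and pos: "\<And>i. i < N \<Longrightarrow> k i > 0"
    and eqv: "\<And>i a c. i < N \<Longrightarrow> a \<in> csphere N \<Longrightarrow> cmod c = 1 \<Longrightarrow> F i (\<lambda>l. c * a l) = c ^ k i * F i a"
  shows "\<exists>a\<in>csphere N. \<forall>i<N. F i a = 0"
proof -
  obtain m where m: "prime m" "m > (\<Sum>i<N. k i) + 3" using bigger_prime by blast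
  have "\<exists>e. [k i * e = 1] (mod m)" if "i < N" for i
  proof -
    have "k i \<le> (\<Sum>i<N. k i)" by (rule member_le_sum) (use that in auto)
    with m pos[OF that] have "\<not> m dvd k i" by (auto dest: dvd_imp_le)
    hence "coprime (k i) m" using m(1) by (simp add: prime_imp_coprime coprime_commute)
    thus ?thesis using cong_solve_coprime_nat[of "k i" m] by simp
  qed
  then obtain e where e: "\<And>i. i < N \<Longrightarrow> [k i * e i = 1] (mod m)" by metis
  define c where "c = cis (2 * pi / m)"
  have c1: "cmod c = 1" by (simp add: c_def)
  have "c ^ m = cis (real m * (2 * pi / m))" unfolding c_def by (rule Complex.DeMoivre)
  also have "\<dots> = 1" using m by simp
  finally have cm: "c ^ m = 1" .
  have c_pow: "c ^ (k i * e i) = c" if "i < N" for i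
  proof -
    have "c ^ j = c ^ (j mod m)" for j
    proof -
      have "c ^ j = c ^ (m * (j div m) + j mod m)" by simp
      also have "\<dots> = c ^ (j mod m)" by (simp only: power_add power_mult cm power_one mult_1)
      finally show ?thesis .
    qed
    hence "c ^ (k i * e i) = c ^ (k i * e i mod m)" .
    also have "\<dots> = c ^ (1 mod m)" using arg_cong[OF e[OF that, unfolded unique_euclidean_semiring_class.cong_def], of "\<lambda>j. c ^ j"] .
    also have "\<dots> = c" using m by simp
    finally show ?thesis .
  qed
  let ?X = "nsphere (2 * N + 1)"
  have rot: "rotate_coords c x \<in> topspace ?X" if "x \<in> topspace ?X" for x
    using that unfolding topspace_nsphere_odd_iff to_complex_rotate_coords
    by (auto simp: csphere_def norm_mult c1)
  have "\<exists>x\<in>topspace ?X. \<forall>i<N. (F i (to_complex x)) ^ e i = 0"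
  proof (rule equivariant_maps_common_zero[where g = "rotate_coords c" and m = m])
    show "continuous_map ?X ?X (rotate_coords c)"
    proof -
      have "continuous_on UNIV (rotate_coords c)"
      proof (rule continuous_on_coordinatewise_then_product)
        fix l
        have "continuous_on UNIV (\<lambda>x. to_complex x (l div 2))"
          by (rule continuous_on_product_then_coordinatewise[OF continuous_on_to_complex])
        thus "continuous_on UNIV (\<lambda>x. rotate_coords c x l)"
          unfolding rotate_coords_def by (cases "even l") (auto intro!: continuous_intros)
      qed
      hence "continuous_map (top_of_set (topspace ?X)) (top_of_set (topspace ?X)) (rotate_coords c)"
        using rot by (auto simp: continuous_map_in_subtopology intro: continuous_on_subset)
      thus ?thesis by (simp add: nsphere_eq_top_of_set[symmetric])
    qed
    show "(rotate_coords c ^^ m) x = x" for x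
    proof -
      have "to_complex ((rotate_coords c ^^ j) x) = (\<lambda>i. c ^ j * to_complex x i)" for j
        by (induction j) (simp_all add: to_complex_rotate_coords mult.assoc)
      from this[of m] show ?thesis by (simp add: cm inj_eq[OF inj_to_complex])
    qed
    show "trivial_group (homology_group (int i) ?X)" if "0 < i" "i < 2 * N" for i
      using reduced_homology_group_nsphere(2)[of "int i" "2 * N + 1"] that
      by (simp add: un_reduced_homology_group)
    show "continuous_map ?X euclidean (\<lambda>x. (F i (to_complex x)) ^ e i)" if "i < N" for i
    proof (subst nsphere_eq_top_of_set, subst continuous_map_iff_continuous)
      show "continuous_on (topspace ?X) (\<lambda>x. (F i (to_complex x)) ^ e i)"
        by (intro continuous_on_power continuous_on_compose2[OF cont[OF that] continuous_on_to_complex])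
           (use topspace_nsphere_odd_iff in blast)
    qed
    show "(F i (to_complex (rotate_coords c x))) ^ e i = cis (2 * pi / m) * (F i (to_complex x)) ^ e i"
      if "i < N" "x \<in> topspace ?X" for i x
    proof -
      have "to_complex x \<in> csphere N" using that(2) topspace_nsphere_odd_iff by blast
      from eqv[OF that(1) this c1] show ?thesis
        using c_pow[OF that(1)]
        by (simp add: to_complex_rotate_coords power_mult_distrib power_mult[symmetric] c_def[symmetric])
    qed
  qed (use m in \<open>auto intro!: path_connected_space_nsphere\<close>)
  then obtain x where "x \<in> topspace ?X" "\<forall>i<N. F i (to_complex x) = 0"
    by auto
  thus ?thesis using topspace_nsphere_odd_iff by blast
qed

section \<open>The Fourier tail of an arc\<close>

lemma ln_Gamma_reflection:
  assumes "0 < x" "x < (1::real)"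
  shows "ln_Gamma x + ln_Gamma (1 - x) = ln pi - ln (sin (pi * x))"
proof -
  have s: "sin (pi * x) > 0" using assms by (intro sin_gt_zero) auto
  have "complex_of_real (Gamma x * Gamma (1 - x)) = complex_of_real (pi / sin (pi * x))"
    using Gamma_reflection_complex[of "complex_of_real x"]
    by (simp add: Gamma_complex_of_real[symmetric] sin_of_real[symmetric])
  hence "Gamma x * Gamma (1 - x) = pi / sin (pi * x)" by (simp only: of_real_eq_iff)
  hence "ln (Gamma x * Gamma (1 - x)) = ln (pi / sin (pi * x))" by simp
  moreover have "Gamma x > 0" "Gamma (1 - x) > 0" using assms by simp_all
  ultimately show ?thesis using assms s by (simp add: ln_mult ln_div ln_Gamma_real_pos)
qed

lemma Digamma_reflection:
  assumes "0 < x" "x < (1::real)"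
  shows "Digamma x - Digamma (1 - x) = - pi * cos (pi * x) / sin (pi * x)"
proof -
  have s: "sin (pi * x) > 0" using assms by (intro sin_gt_zero) auto
  have "((\<lambda>x. ln_Gamma x + ln_Gamma (1 - x)) has_field_derivative Digamma x - Digamma (1 - x)) (at x)"
    using assms by (auto intro!: derivative_eq_intros)
  moreover have "((\<lambda>x. ln pi - ln (sin (pi * x))) has_field_derivative - pi * cos (pi * x) / sin (pi * x)) (at x)"
    using s by (auto intro!: derivative_eq_intros)
  hence "((\<lambda>x. ln_Gamma x + ln_Gamma (1 - x)) has_field_derivative - pi * cos (pi * x) / sin (pi * x)) (at x)"
  proof (rule has_field_derivative_transform_within_open[where S = "{0<..<1}"])
    show "ln pi - ln (sin (pi * y)) = ln_Gamma y + ln_Gamma (1 - y)" if "y \<in> {0<..<1}" for y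
      using ln_Gamma_reflection[of y] that by simp
  qed (use assms in auto)
  ultimately show ?thesis by (rule DERIV_unique)
qed

text \<open>
  The partial fraction expansion of \<open>(\<pi> / sin (\<pi> x))\<^sup>2\<close>, obtained by differentiating the logarithm
  of Euler's reflection formula twice.
\<close>

lemma Polygamma_1_reflection:
  assumes "0 < x" "x < (1::real)"
  shows "Polygamma 1 x + Polygamma 1 (1 - x) = (pi / sin (pi * x))\<^sup>2"
proof -
  have s: "sin (pi * y) > 0" if "y \<in> {0<..<1}" for y using that by (intro sin_gt_zero) auto
  have nn: "y \<notin> \<int>\<^sub>\<le>\<^sub>0" if "y > 0" for y :: real using that by (auto elim!: nonpos_Ints_cases')
  have "((\<lambda>x. Digamma x - Digamma (1 - x)) has_field_derivative Polygamma 1 x + Polygamma 1 (1 - x)) (at x)"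
    using assms by (auto intro!: derivative_eq_intros nn)
  moreover have "((\<lambda>x. - pi * cos (pi * x) / sin (pi * x)) has_field_derivative (pi / sin (pi * x))\<^sup>2) (at x)"
  proof -
    have pythagoras: "u * (u * (c * (c * (t * t)))) + u * (u * (t * (t * (t * t)))) = u * (u * (t * t))"
      if "t\<^sup>2 + c\<^sup>2 = 1" for u c t :: real
    proof -
      have "u * (u * (c * (c * (t * t)))) + u * (u * (t * (t * (t * t)))) = u * (u * (t * t)) * (t\<^sup>2 + c\<^sup>2)"
        by (simp add: power2_eq_square algebra_simps)
      thus ?thesis using that by simp
    qed
    have "((\<lambda>x. - pi * cos (pi * x) / sin (pi * x)) has_field_derivative
        (pi\<^sup>2 * ((sin (pi * x))\<^sup>2 + (cos (pi * x))\<^sup>2)) / (sin (pi * x))\<^sup>2) (at x)"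
      using s[of x] assms by (auto intro!: derivative_eq_intros simp: power2_eq_square field_simps pythagoras[OF sin_cos_squared_add])
    thus ?thesis by (simp add: power_divide)
  qed
  hence "((\<lambda>x. Digamma x - Digamma (1 - x)) has_field_derivative (pi / sin (pi * x))\<^sup>2) (at x)"
  proof (rule has_field_derivative_transform_within_open[where S = "{0<..<1}"])
    show "- pi * cos (pi * y) / sin (pi * y) = Digamma y - Digamma (1 - y)" if "y \<in> {0<..<1}" for y
      using Digamma_reflection[of y] that by simp
  qed (use assms in auto)
  ultimately show ?thesis by (rule DERIV_unique)
qed

lemma Polygamma_1_sums:
  assumes "(x::real) > 0"
  shows "(\<lambda>k. 1 / (x + real k)\<^sup>2) sums Polygamma 1 x"
  using Polygamma_converges'[of x 2] assms
  by (simp add: Polygamma_def numeral_2_eq_2 summable_sums inverse_eq_divide)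

text \<open>
  The numerator depends on \<open>k\<close> modulo \<open>q\<close> only.
\<close>

lemma sum_sin_squares_by_residue:
  assumes "q \<ge> 1"
  shows "(\<Sum>k<M * q. (sin (pi * real k / q))\<^sup>2 / (real k)\<^sup>2) =
     (\<Sum>r\<in>{1..<q}. (sin (pi * r / q))\<^sup>2 / (real q)\<^sup>2 * (\<Sum>j<M. 1 / (real r / q + real j)\<^sup>2))"
proof -
  have periodic: "(sin (pi * real (j * q + r) / q))\<^sup>2 = (sin (pi * r / q))\<^sup>2" for j r
  proof -
    have "pi * real (j * q + r) / q = pi * r / q + real j * pi"
      using assms by (simp add: field_simps)
    also have "(sin (pi * r / q + real j * pi))\<^sup>2 = (sin (pi * r / q))\<^sup>2"
      by (simp add: sin_add power_mult_distrib) (simp add: power2_eq_square flip: power_mult_distrib)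
    finally show ?thesis .
  qed
  have "(\<Sum>k<M * q. (sin (pi * real k / q))\<^sup>2 / (real k)\<^sup>2)
      = (\<Sum>j<M. \<Sum>k=j*q..<j*q+q. (sin (pi * real k / q))\<^sup>2 / (real k)\<^sup>2)"
    using sum.nat_group[of "\<lambda>k. (sin (pi * real k / q))\<^sup>2 / (real k)\<^sup>2" q M] by (simp add: mult.commute)
  also have "\<dots> = (\<Sum>j<M. \<Sum>r<q. (sin (pi * real (j * q + r) / q))\<^sup>2 / (real (j * q + r))\<^sup>2)"
  proof (rule sum.cong[OF refl])
    fix j
    show "(\<Sum>k=j*q..<j*q+q. (sin (pi * real k / q))\<^sup>2 / (real k)\<^sup>2) =
          (\<Sum>r<q. (sin (pi * real (j * q + r) / q))\<^sup>2 / (real (j * q + r))\<^sup>2)"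
      using sum.shift_bounds_nat_ivl[of "\<lambda>k. (sin (pi * real k / q))\<^sup>2 / (real k)\<^sup>2" 0 "j * q" q]
      by (simp add: atLeast0LessThan add.commute)
  qed
  also have "\<dots> = (\<Sum>r<q. \<Sum>j<M. (sin (pi * r / q))\<^sup>2 / (real (j * q + r))\<^sup>2)"
    unfolding periodic by (rule sum.swap)
  also have "\<dots> = (\<Sum>r\<in>{1..<q}. \<Sum>j<M. (sin (pi * r / q))\<^sup>2 / (real (j * q + r))\<^sup>2)"
    by (rule sum.mono_neutral_right) (auto simp: not_le)
  also have "\<dots> = (\<Sum>r\<in>{1..<q}. (sin (pi * r / q))\<^sup>2 / (real q)\<^sup>2 * (\<Sum>j<M. 1 / (real r / q + real j)\<^sup>2))"
    unfolding sum_distrib_left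
  proof (intro sum.cong refl)
    fix r j
    have "real (j * q + r) = q * (real r / q + real j)" using assms by (simp add: field_simps)
    thus "(sin (pi * r / q))\<^sup>2 / (real (j * q + r))\<^sup>2 = (sin (pi * r / q))\<^sup>2 / (real q)\<^sup>2 * (1 / (real r / q + real j)\<^sup>2)"
      by (simp add: power_mult_distrib)
  qed
  finally show ?thesis .
qed

text \<open>
  Parseval's identity for the indicator of an arc of length \<open>2 \<pi> / q\<close>. The contributions of the
  residues \<open>r\<close> and \<open>q - r\<close> add up to a partial fraction expansion in which the sine cancels.
\<close>

lemma sum_sin_squares_tendsto:
  assumes "q \<ge> 1"
  shows "(\<lambda>M. \<Sum>k<M * q. (sin (pi * real k / q))\<^sup>2 / (real k)\<^sup>2) \<longlonglongrightarrow> pi\<^sup>2 / 2 * (1 / q - 1 / (real q)\<^sup>2)"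
proof -
  define P where "P r = (sin (pi * real r / q))\<^sup>2 / (real q)\<^sup>2 * Polygamma 1 (real r / q)" for r
  have "(\<lambda>M. \<Sum>k<M * q. (sin (pi * real k / q))\<^sup>2 / (real k)\<^sup>2) \<longlonglongrightarrow> (\<Sum>r\<in>{1..<q}. P r)"
    unfolding sum_sin_squares_by_residue[OF assms] P_def
    by (intro tendsto_sum tendsto_mult tendsto_const Polygamma_1_sums[unfolded sums_def]) (use assms in auto)
  moreover have "2 * (\<Sum>r\<in>{1..<q}. P r) = (\<Sum>r\<in>{1..<q}. P r + P (q - r))"
  proof -
    have "(\<Sum>r\<in>{1..<q}. P (q - r)) = (\<Sum>r\<in>{1..<q}. P r)"
      by (rule sum.reindex_bij_witness[where i = "\<lambda>r. q - r" and j = "\<lambda>r. q - r"]) auto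
    thus ?thesis by (simp add: sum.distrib)
  qed
  moreover have "P r + P (q - r) = pi\<^sup>2 / (real q)\<^sup>2" if "r \<in> {1..<q}" for r
  proof -
    define x where "x = real r / q"
    have x: "0 < x" "x < 1" using that by (auto simp: x_def)
    have q: "real (q - r) / q = 1 - x" using that by (simp add: x_def field_simps of_nat_diff)
    have "sin (pi * (1 - x)) = sin (pi * x)"
      by (simp add: right_diff_distrib sin_diff)
    moreover have "sin (pi * x) > 0" using x by (intro sin_gt_zero) auto
    ultimately show ?thesis
      using Polygamma_1_reflection[OF x] 
      unfolding P_def times_divide_eq_right[symmetric] q x_def[symmetric]
      by (simp add: distrib_left[symmetric] add_divide_distrib[symmetric] power_divide)
  qed
  hence "(\<Sum>r\<in>{1..<q}. P r + P (q - r)) = (real q - 1) * (pi\<^sup>2 / (real q)\<^sup>2)"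
    using assms by (simp add: of_nat_diff)
  ultimately have lim: "(\<lambda>M. \<Sum>k<M * q. (sin (pi * real k / q))\<^sup>2 / (real k)\<^sup>2) \<longlonglongrightarrow> (\<Sum>r\<in>{1..<q}. P r)"
    and "2 * (\<Sum>r\<in>{1..<q}. P r) = (real q - 1) * (pi\<^sup>2 / (real q)\<^sup>2)"
    by simp_all
  hence eq: "(\<Sum>r\<in>{1..<q}. P r) = pi\<^sup>2 / 2 * (1 / q - 1 / (real q)\<^sup>2)"
    using assms by (simp add: field_simps power2_eq_square)
  show ?thesis using lim unfolding eq .
qed

lemma sum_inverse_squares_le:
  fixes n N :: nat
  assumes "n \<ge> 1"
  shows "(\<Sum>k\<in>{n<..<N}. 1 / (real k)\<^sup>2) \<le> 1 / n"
proof (cases "n < N")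
  case True
  have "(\<Sum>k\<in>{n<..n + j}. 1 / (real k)\<^sup>2) \<le> 1 / n - 1 / (n + j)" for j
  proof (induction j)
    case (Suc j)
    have pos: "real n + real j > 0" using assms by simp
    have "1 / (real (n + Suc j))\<^sup>2 \<le> 1 / ((real n + real j) * (real n + real j + 1))"
      using pos by (intro divide_left_mono) (auto simp: power2_eq_square intro!: mult_mono mult_pos_pos)
    also have "\<dots> = 1 / (real n + real j) - 1 / (real n + real j + 1)"
      using pos by (simp add: divide_simps)
    moreover have "{n<..n + Suc j} = insert (n + Suc j) {n<..n + j}" by auto
    ultimately show ?case using Suc by (simp add: add_ac)
  qed simp
  from this[of "N - 1 - n"] True have "(\<Sum>k\<in>{n<..N - 1}. 1 / (real k)\<^sup>2) \<le> 1 / n - 1 / (N - 1)"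
    by (simp add: of_nat_diff)
  also have "{n<..N - 1} = {n<..<N}" using True by auto
  also have "1 / real n - 1 / real (N - 1) \<le> 1 / n" by simp
  finally show ?thesis .
qed auto

text \<open>
  The left-hand side is the squared \<open>L\<^sup>2\<close>-norm of the Fourier tail of the arc; bounding the sine by
  one makes the estimate uniform in \<open>q\<close>.
\<close>

lemma sin_squares_tail:
  fixes q n :: nat
  assumes "q \<ge> 1" "n \<ge> 1"
  shows "1 / q - 1 / (real q)\<^sup>2 - (\<Sum>k\<in>{1..n}. 2 * (sin (pi * real k / q))\<^sup>2 / (pi * real k)\<^sup>2) \<le> 2 / (pi\<^sup>2 * n)"
proof -
  let ?s = "\<lambda>k. (sin (pi * real k / q))\<^sup>2 / (real k)\<^sup>2"
  have "pi\<^sup>2 / 2 * (1 / q - 1 / (real q)\<^sup>2) \<le> (\<Sum>k\<in>{1..n}. ?s k) + 1 / n"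
  proof (rule LIMSEQ_le_const2[OF sum_sin_squares_tendsto[OF assms(1)]], intro exI allI impI)
    fix M :: nat assume "M \<ge> 0"
    have "(\<Sum>k<M * q. ?s k) \<le> (\<Sum>k\<in>{0..n} \<union> {n<..<M * q}. ?s k)"
      by (rule sum_mono2) auto
    also have "\<dots> = (\<Sum>k\<in>{0..n}. ?s k) + (\<Sum>k\<in>{n<..<M * q}. ?s k)"
      by (rule sum.union_disjoint) auto
    also have "(\<Sum>k\<in>{0..n}. ?s k) = (\<Sum>k\<in>{1..n}. ?s k)"
      by (rule sum.mono_neutral_right) auto
    also have "(\<Sum>k\<in>{n<..<M * q}. ?s k) \<le> (\<Sum>k\<in>{n<..<M * q}. 1 / (real k)\<^sup>2)"
      by (intro sum_mono divide_right_mono) (auto simp: abs_square_le_1)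
    also have "\<dots> \<le> 1 / n" by (rule sum_inverse_squares_le[OF assms(2)])
    finally show "(\<Sum>k<M * q. ?s k) \<le> (\<Sum>k\<in>{1..n}. ?s k) + 1 / n" by simp
  qed
  hence "2 / pi\<^sup>2 * (pi\<^sup>2 / 2 * (1 / q - 1 / (real q)\<^sup>2)) \<le> 2 / pi\<^sup>2 * ((\<Sum>k\<in>{1..n}. ?s k) + 1 / n)"
    by (intro mult_left_mono) auto
  also have "\<dots> = (\<Sum>k\<in>{1..n}. 2 * (sin (pi * real k / q))\<^sup>2 / (pi * real k)\<^sup>2) + 2 / (pi\<^sup>2 * n)"
    by (simp add: sum_distrib_left distrib_left power_mult_distrib)
  finally show ?thesis by simp
qed

lemma has_integral_cos_multiple:
  assumes "r \<noteq> 0" "c \<ge> 0"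
  shows "((\<lambda>t. cos (r * t)) has_integral 2 * sin (r * c) / r) {-c..c::real}"
proof -
  have "((\<lambda>t. cos (r * t)) has_integral sin (r * c) / r - sin (r * (- c)) / r) {-c..c}"
    using assms
    by (intro fundamental_theorem_of_calculus)
       (auto intro!: derivative_eq_intros simp: has_real_derivative_iff_has_vector_derivative[symmetric])
  thus ?thesis by simp
qed

lemma has_integral_cos_nat_mult:
  assumes "k > 0"
  shows "((\<lambda>t. cos (real k * t)) has_integral 0) {-pi..pi}"
  using has_integral_cos_multiple[of "real k" pi] assms by simp

lemma has_integral_cos_times_cos:
  assumes "k > 0" "l > 0"
  shows "((\<lambda>t. cos (real k * t) * cos (real l * t)) has_integral (if k = l then pi else 0)) {-pi..pi}"
proof -
  have plus: "((\<lambda>t. cos ((real k + real l) * t)) has_integral 0) {-pi..pi}"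
    using has_integral_cos_nat_mult[of "k + l"] assms by simp
  have minus: "((\<lambda>t. cos ((real k - real l) * t)) has_integral (if k = l then 2 * pi else 0)) {-pi..pi}"
  proof (cases "k = l")
    case True
    thus ?thesis using has_integral_const_real[of "1 :: real" "-pi" pi] by simp
  next
    case False
    have "sin ((real k - real l) * pi) = 0"
      by (simp add: left_diff_distrib sin_diff)
    thus ?thesis using has_integral_cos_multiple[of "real k - real l" pi] False by simp
  qed
  have "(\<lambda>t. cos (real k * t) * cos (real l * t)) =
      (\<lambda>t. (cos ((real k - real l) * t) + cos ((real k + real l) * t)) / 2)"
    by (simp add: fun_eq_iff left_diff_distrib distrib_right cos_add cos_diff)
  thus ?thesis
    using has_integral_divide[OF has_integral_add[OF minus plus], of 2] by (cases "k = l") simp_all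
qed

definition arc_indicator :: "nat \<Rightarrow> complex \<Rightarrow> real" where
  "arc_indicator q z = (if \<bar>Arg z\<bar> \<le> pi / q then 1 else 0)"

text \<open>
  The coefficient of \<open>cos (k t)\<close> in the Fourier series of the arc.
\<close>

definition arc_coeff :: "nat \<Rightarrow> nat \<Rightarrow> real" where
  "arc_coeff q k = 2 * sin (pi * real k / q) / (pi * real k)"

definition arc_remainder :: "nat \<Rightarrow> nat \<Rightarrow> complex \<Rightarrow> real" where
  "arc_remainder q n z = arc_indicator q z - 1 / q - (\<Sum>k\<in>{1..n}. arc_coeff q k * Re (z ^ k))"

lemma arc_indicator_cis:
  assumes "q \<ge> 1" "t \<in> {-pi<..pi}"
  shows "arc_indicator q (cis t) = (if t \<in> {-(pi/q)..pi/q} then 1 else 0)"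
proof -
  have "Arg (cis t) = t" using assms by (intro cis_Arg_unique) auto
  thus ?thesis by (auto simp: arc_indicator_def)
qed

text \<open>
  Orthogonality of the cosines: subtracting a partial Fourier sum from the centred indicator
  decreases the squared norm by the squared norm of that sum.
\<close>

lemma arc_remainder_L2:
  assumes "q \<ge> 1"
  shows "((\<lambda>t. (arc_remainder q n (cis t))\<^sup>2) has_integral
      2 * pi * (1 / q - 1 / (real q)\<^sup>2 - (\<Sum>k\<in>{1..n}. 2 * (sin (pi * real k / q))\<^sup>2 / (pi * real k)\<^sup>2))) {-pi..pi}"
proof -
  define J where "J = {-(pi/q)..pi/q}"
  have J: "J \<subseteq> {-pi..pi}"
  proof -
    have "pi / q \<le> pi" using assms by (simp add: divide_le_eq)
    thus ?thesis by (auto simp: J_def)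
  qed
  define H where "H t = (if t \<in> J then 1 else 0) - 1 / real q" for t
  define P where "P t = (\<Sum>k\<in>{1..n}. arc_coeff q k * cos (real k * t))" for t
  have Jint: "((\<lambda>t. if t \<in> J then f t else 0) has_integral i) {-pi..pi}" if "(f has_integral i) J"
    for f :: "real \<Rightarrow> real" and i
    using that J by (subst has_integral_restrict) auto
  have HH: "((\<lambda>t. H t * H t) has_integral 2 * pi * (1 / q - 1 / (real q)\<^sup>2)) {-pi..pi}"
  proof -
    have 1: "((\<lambda>t. if t \<in> J then 1 - 2 / real q else 0) has_integral (1 - 2 / real q) * (2 * (pi / q))) {-pi..pi}"
      by (rule Jint) (use has_integral_const_real[of "1 - 2 / real q" "-(pi/q)" "pi/q"] in \<open>simp add: J_def mult_ac\<close>)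
    have 2: "((\<lambda>t. 1 / (real q)\<^sup>2) has_integral 1 / (real q)\<^sup>2 * (2 * pi)) {-pi..pi}"
      using has_integral_const_real[of "1 / (real q)\<^sup>2" "-pi" pi] by (simp add: mult_ac)
    have "(\<lambda>t. H t * H t) = (\<lambda>t. (if t \<in> J then 1 - 2 / real q else 0) + 1 / (real q)\<^sup>2)"
      using assms by (auto simp: H_def fun_eq_iff power2_eq_square field_simps)
    moreover have "(1 - 2 / real q) * (2 * (pi / q)) + 1 / (real q)\<^sup>2 * (2 * pi) = 2 * pi * (1 / q - 1 / (real q)\<^sup>2)"
      using assms by (simp add: field_simps power2_eq_square)
    ultimately show ?thesis using has_integral_add[OF 1 2] by simp
  qed
  have HC: "((\<lambda>t. H t * cos (real k * t)) has_integral pi * arc_coeff q k) {-pi..pi}" if "k \<in> {1..n}" for k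
  proof -
    have k: "real k \<noteq> 0" using that by simp
    have 1: "((\<lambda>t. if t \<in> J then cos (real k * t) else 0) has_integral 2 * sin (real k * (pi / q)) / real k) {-pi..pi}"
      unfolding J_def by (rule Jint[unfolded J_def]) (rule has_integral_cos_multiple[OF k], simp)
    have 2: "((\<lambda>t. cos (real k * t) / real q) has_integral 0 / real q) {-pi..pi}"
      by (rule has_integral_divide[OF has_integral_cos_nat_mult]) (use that in simp)
    have "(\<lambda>t. H t * cos (real k * t)) = (\<lambda>t. (if t \<in> J then cos (real k * t) else 0) - cos (real k * t) / real q)"
      by (auto simp: H_def fun_eq_iff left_diff_distrib)
    moreover have "2 * sin (real k * (pi / q)) / real k - 0 / real q = pi * arc_coeff q k"
      by (simp add: arc_coeff_def mult_ac)
    ultimately show ?thesis using has_integral_diff[OF 1 2] by simp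
  qed
  have HP: "((\<lambda>t. H t * P t) has_integral (\<Sum>k\<in>{1..n}. arc_coeff q k * (pi * arc_coeff q k))) {-pi..pi}"
  proof -
    have "((\<lambda>t. \<Sum>k\<in>{1..n}. arc_coeff q k * (H t * cos (real k * t)))
       has_integral (\<Sum>k\<in>{1..n}. arc_coeff q k * (pi * arc_coeff q k))) {-pi..pi}"
      by (intro has_integral_sum has_integral_mult_right HC) auto
    thus ?thesis by (simp add: P_def sum_distrib_left mult_ac)
  qed
  have PP: "((\<lambda>t. P t * P t) has_integral (\<Sum>k\<in>{1..n}. arc_coeff q k * (pi * arc_coeff q k))) {-pi..pi}"
  proof -
    have "((\<lambda>t. \<Sum>k\<in>{1..n}. \<Sum>l\<in>{1..n}. arc_coeff q k * (arc_coeff q l * (cos (real k * t) * cos (real l * t))))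
       has_integral (\<Sum>k\<in>{1..n}. \<Sum>l\<in>{1..n}. arc_coeff q k * (arc_coeff q l * (if k = l then pi else 0)))) {-pi..pi}"
      by (intro has_integral_sum has_integral_mult_right has_integral_cos_times_cos) auto
    moreover have "(\<Sum>l\<in>{1..n}. arc_coeff q k * (arc_coeff q l * (if k = l then pi else 0))) = arc_coeff q k * (pi * arc_coeff q k)"
      if "k \<in> {1..n}" for k
      using that by (simp add: if_distrib cong: if_cong)
    ultimately show ?thesis
      by (simp add: P_def sum_product mult_ac)
  qed
  have "((\<lambda>t. H t * H t - 2 * (H t * P t) + P t * P t) has_integral
     (2 * pi * (1 / q - 1 / (real q)\<^sup>2) - 2 * (\<Sum>k\<in>{1..n}. arc_coeff q k * (pi * arc_coeff q k))
       + (\<Sum>k\<in>{1..n}. arc_coeff q k * (pi * arc_coeff q k)))) {-pi..pi}"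
    by (intro has_integral_add has_integral_diff has_integral_mult_right HH HP PP)
  moreover have "2 * pi * (1 / q - 1 / (real q)\<^sup>2) - 2 * (\<Sum>k\<in>{1..n}. arc_coeff q k * (pi * arc_coeff q k))
       + (\<Sum>k\<in>{1..n}. arc_coeff q k * (pi * arc_coeff q k)) =
       2 * pi * (1 / q - 1 / (real q)\<^sup>2 - (\<Sum>k\<in>{1..n}. 2 * (sin (pi * real k / q))\<^sup>2 / (pi * real k)\<^sup>2))"
  proof -
    have "arc_coeff q k * (pi * arc_coeff q k) = 2 * pi * (2 * (sin (pi * real k / q))\<^sup>2 / (pi * real k)\<^sup>2)" for k
      by (simp add: arc_coeff_def power2_eq_square)
    hence "(\<Sum>k\<in>{1..n}. arc_coeff q k * (pi * arc_coeff q k)) = 2 * pi * (\<Sum>k\<in>{1..n}. 2 * (sin (pi * real k / q))\<^sup>2 / (pi * real k)\<^sup>2)"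
      by (simp add: sum_distrib_left)
    thus ?thesis by (simp add: right_diff_distrib)
  qed
  ultimately have "((\<lambda>t. H t * H t - 2 * (H t * P t) + P t * P t) has_integral
       2 * pi * (1 / q - 1 / (real q)\<^sup>2 - (\<Sum>k\<in>{1..n}. 2 * (sin (pi * real k / q))\<^sup>2 / (pi * real k)\<^sup>2))) {-pi..pi}"
    by metis
  \<comment> \<open>At \<open>-\<pi>\<close> the principal argument of \<open>cis t\<close> is \<open>\<pi>\<close>, not \<open>t\<close>.\<close>
  thus ?thesis
  proof (rule has_integral_spike_finite[of "{-pi}", rotated 2])
    show "(arc_remainder q n (cis t))\<^sup>2 = H t * H t - 2 * (H t * P t) + P t * P t"
      if "t \<in> {-pi..pi} - {-pi}" for t
    proof -
      have "t \<in> {-pi<..pi}" using that by auto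
      hence eq: "arc_remainder q n (cis t) = H t - P t"
        unfolding arc_remainder_def H_def P_def J_def
        by (subst arc_indicator_cis[OF assms]) (auto simp: Complex.DeMoivre)
      show ?thesis unfolding eq
        by (simp add: power2_eq_square algebra_simps)
    qed
  qed simp
qed

section \<open>Averages over the circle\<close>

lemma integral_circle_measure:
  fixes g :: "complex \<Rightarrow> real"
  assumes "g \<in> borel_measurable borel"
  shows "(\<integral>z. g z \<partial>circle_measure) = (LINT t:{0..<2*pi}|lborel. g (cis t)) / (2 * pi)"
proof -
  have cis [measurable]: "cis \<in> borel_measurable borel"
    by (intro borel_measurable_continuous_onI continuous_intros)
  have [measurable]: "(\<lambda>t. g (cis t)) \<in> borel_measurable borel"
    using assms by measurable
  have "cis \<in> uniform_measure lborel {0..<2*pi} \<rightarrow>\<^sub>M restrict_space borel (sphere 0 1)"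
    by (intro measurable_restrict_space2) auto
  hence "(\<integral>z. g z \<partial>circle_measure) = (\<integral>t. g (cis t) \<partial>uniform_measure lborel {0..<2*pi})"
    unfolding circle_measure_def using assms
    by (intro integral_distr) (auto intro: measurable_restrict_space1)
  also have "uniform_measure lborel {0..<2*pi} = density lborel (\<lambda>t. ennreal (indicator {0..<2*pi} t / (2 * pi)))"
    unfolding uniform_measure_def
    by (intro density_cong) (auto simp: divide_ennreal[symmetric] split: split_indicator)
  also have "(\<integral>t. g (cis t) \<partial>density lborel (\<lambda>t. ennreal (indicator {0..<2*pi} t / (2 * pi))))
     = (\<integral>t. (indicator {0..<2*pi} t / (2 * pi)) *\<^sub>R g (cis t) \<partial>lborel)"
    by (rule integral_density) auto
  also have "\<dots> = (\<integral>t. (indicator {0..<2*pi} t *\<^sub>R g (cis t)) / (2 * pi) \<partial>lborel)"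
    by (intro Bochner_Integration.integral_cong) simp_all
  also have "\<dots> = (LINT t:{0..<2*pi}|lborel. g (cis t)) / (2 * pi)"
    unfolding set_lebesgue_integral_def by (rule integral_divide_zero)
  finally show ?thesis .
qed

lemma set_integral_translate:
  fixes G :: "real \<Rightarrow> real"
  shows "(LINT t:{a..<b}|lborel. G (t + c)) = (LINT t:{a + c..<b + c}|lborel. G t)"
proof -
  have "(LINT t:{a + c..<b + c}|lborel. G t) =
    (\<integral>t. indicator {a + c..<b + c} (c + 1 * t) *\<^sub>R G (c + 1 * t) \<partial>lborel)"
    unfolding set_lebesgue_integral_def by (subst lborel_integral_real_affine[of 1 _ c]) auto
  also have "\<dots> = (LINT t:{a..<b}|lborel. G (t + c))"
    unfolding set_lebesgue_integral_def
    by (intro Bochner_Integration.integral_cong) (auto simp: add.commute split: split_indicator)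
  finally show ?thesis by simp
qed

lemma set_integral_period:
  fixes G :: "real \<Rightarrow> real"
  assumes [measurable]: "G \<in> borel_measurable borel" and bound: "\<And>t. \<bar>G t\<bar> \<le> B"
    and per: "\<And>t. G (t + 2 * pi) = G t" and a: "0 \<le> a" "a \<le> 2 * pi"
  shows "(LINT t:{a..<a + 2 * pi}|lborel. G t) = (LINT t:{0..<2 * pi}|lborel. G t)"
proof -
  have int: "set_integrable lborel {c..<d} G" for c d :: real
    unfolding set_integrable_def
  proof (rule integrableI_bounded_set_indicator[where B = B])
    show "emeasure lborel {c..<d} < \<infinity>" by (cases "c \<le> d") auto
  qed (auto simp: bound)
  have "(LINT t:{a..<a + 2 * pi}|lborel. G t)
      = (LINT t:{a..<2 * pi} \<union> {2 * pi..<a + 2 * pi}|lborel. G t)"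
    using a by (intro arg_cong2[where f = "\<lambda>A f. set_lebesgue_integral lborel A f"] refl) auto
  also have "\<dots> = (LINT t:{a..<2 * pi}|lborel. G t) + (LINT t:{2 * pi..<a + 2 * pi}|lborel. G t)"
    by (intro set_integral_Un int) auto
  also have "(LINT t:{2 * pi..<a + 2 * pi}|lborel. G t) = (LINT t:{0..<a}|lborel. G t)"
    using set_integral_translate[of 0 a G "2 * pi"] by (simp add: per)
  also have "(LINT t:{a..<2 * pi}|lborel. G t) + (LINT t:{0..<a}|lborel. G t)
      = (LINT t:{a..<2 * pi} \<union> {0..<a}|lborel. G t)"
    by (intro set_integral_Un[symmetric] int) auto
  also have "{a..<2 * pi} \<union> {0..<a} = {0..<2 * pi}" using a by auto
  finally show ?thesis .
qed

lemma circle_integral_rotate: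
  fixes g :: "complex \<Rightarrow> real"
  assumes [measurable]: "g \<in> borel_measurable borel" and bound: "\<And>z. cmod z = 1 \<Longrightarrow> \<bar>g z\<bar> \<le> B"
    and c: "cmod c = 1"
  shows "(\<integral>z. g (z * c) \<partial>circle_measure) = (\<integral>z. g z \<partial>circle_measure)"
proof -
  define a where "a = Arg2pi c"
  have a: "0 \<le> a" "a < 2 * pi" "c = cis a"
    using Arg2pi[of c] c by (simp_all add: a_def cis_conv_exp is_Arg_def)
  have cis [measurable]: "cis \<in> borel_measurable borel"
    by (intro borel_measurable_continuous_onI continuous_intros)
  have "(LINT t:{0..<2*pi}|lborel. g (cis t * c)) = (LINT t:{0..<2*pi}|lborel. g (cis (t + a)))"
    by (simp add: a cis_mult)
  also have "\<dots> = (LINT t:{a..<a + 2*pi}|lborel. g (cis t))"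
    using set_integral_translate[of 0 "2*pi" "\<lambda>t. g (cis t)" a] by (simp add: add.commute)
  also have "\<dots> = (LINT t:{0..<2*pi}|lborel. g (cis t))"
    using a by (intro set_integral_period[where B = B]) (auto simp: bound cis_mult[symmetric])
  finally show ?thesis
    by (subst (1 2) integral_circle_measure) measurable
qed

lemma borel_measurable_arc_remainder [measurable]: "arc_remainder q n \<in> borel_measurable borel"
proof -
  note borel_measurable_Arg[measurable]
  have "(\<lambda>z. Re (z ^ k)) \<in> borel_measurable borel" for k
    by measurable
  thus ?thesis
    unfolding arc_remainder_def[abs_def] arc_indicator_def[abs_def] by measurable
qed

text \<open>
  A crude bound that serves only to make all functions below integrable.
\<close>

definition remainder_bound :: "nat \<Rightarrow> nat \<Rightarrow> real" where
  "remainder_bound q n = 2 + (\<Sum>k\<in>{1..n}. \<bar>arc_coeff q k\<bar>)"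

lemma abs_arc_remainder_le:
  assumes "q \<ge> 1" "cmod z = 1"
  shows "\<bar>arc_remainder q n z\<bar> \<le> remainder_bound q n"
proof -
  have "\<bar>arc_coeff q k * Re (z ^ k)\<bar> \<le> \<bar>arc_coeff q k\<bar>" for k
    using abs_Re_le_cmod[of "z ^ k"] assms(2)
    by (simp add: abs_mult norm_power mult_left_le)
  hence "\<bar>\<Sum>k\<in>{1..n}. arc_coeff q k * Re (z ^ k)\<bar> \<le> (\<Sum>k\<in>{1..n}. \<bar>arc_coeff q k\<bar>)"
    by (intro order_trans[OF sum_abs] sum_mono)
  moreover have "\<bar>arc_indicator q z\<bar> \<le> 1" "\<bar>1 / real q\<bar> \<le> 1" using assms by (simp_all add: arc_indicator_def)
  ultimately show ?thesis unfolding arc_remainder_def remainder_bound_def by linarith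
qed

lemma arc_remainder_circle_L2:
  assumes "q \<ge> 1" "n \<ge> 1"
  shows "(\<integral>z. (arc_remainder q n z)\<^sup>2 \<partial>circle_measure) \<le> 2 / (pi\<^sup>2 * n)"
proof -
  define I where "I = 1 / real q - 1 / (real q)\<^sup>2 - (\<Sum>k\<in>{1..n}. 2 * (sin (pi * real k / q))\<^sup>2 / (pi * real k)\<^sup>2)"
  define G where "G t = (arc_remainder q n (cis t))\<^sup>2" for t
  define B where "B = (remainder_bound q n)\<^sup>2"
  have cis [measurable]: "cis \<in> borel_measurable borel"
    by (intro borel_measurable_continuous_onI continuous_intros)
  have [measurable]: "G \<in> borel_measurable borel" unfolding G_def by measurable
  have bound: "\<bar>G t\<bar> \<le> B" for t
    using power_mono[OF abs_arc_remainder_le[OF assms(1), of "cis t" n], of 2] by (simp add: G_def B_def)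
  have per: "G (t + 2 * pi) = G t" for t by (simp add: G_def cis_mult[symmetric])
  have int: "set_integrable lborel {-pi..<pi} G"
    unfolding set_integrable_def
    by (rule integrableI_bounded_set_indicator[where B = B])
       (auto simp: bound)
  have "(G has_integral 2 * pi * I) {-pi..pi}"
    unfolding G_def I_def by (rule arc_remainder_L2[OF assms(1)])
  hence "(G has_integral 2 * pi * I) {-pi..<pi}"
  proof (subst has_integral_restrict[symmetric, of _ "{-pi..pi}"])
    assume "(G has_integral 2 * pi * I) {-pi..pi}"
    thus "((\<lambda>t. if t \<in> {-pi..<pi} then G t else 0) has_integral 2 * pi * I) {-pi..pi}"
      by (rule has_integral_spike_finite[of "{pi}", rotated 2]) auto
  qed auto
  hence "2 * pi * I = (LINT t:{-pi..<pi}|lborel. G t)"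
    using set_borel_integral_eq_integral(2)[OF int] by (simp add: integral_unique)
  also have "\<dots> = (LINT t:{pi..<pi + 2 * pi}|lborel. G t)"
    using set_integral_translate[of "-pi" pi G "2 * pi"] by (simp add: per)
  also have "\<dots> = (LINT t:{0..<2 * pi}|lborel. G t)"
    by (rule set_integral_period[where B = B]) (use bound per in auto)
  finally have "(\<integral>z. (arc_remainder q n z)\<^sup>2 \<partial>circle_measure) = I"
    by (subst integral_circle_measure) (simp_all add: G_def field_simps)
  with sin_squares_tail[OF assms] show ?thesis by (simp add: I_def)
qed

text \<open>
  The variance is nonnegative.
\<close>

lemma (in finite_measure) square_integral_le:
  fixes f :: "'a \<Rightarrow> real"
  assumes f: "integrable M f" and f2: "integrable M (\<lambda>x. (f x)\<^sup>2)"
  shows "(\<integral>x. f x \<partial>M)\<^sup>2 \<le> measure M (space M) * (\<integral>x. (f x)\<^sup>2 \<partial>M)"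
proof (cases "measure M (space M) = 0")
  case True
  hence "AE x in M. f x = 0"
    by (intro AE_I[of _ _ "space M"]) (auto simp: emeasure_eq_measure)
  hence "(\<integral>x. f x \<partial>M) = 0" using integral_eq_zero_AE by blast
  thus ?thesis by (simp add: zero_le_mult_iff)
next
  case False
  define m where "m = measure M (space M)"
  have m: "m > 0" using False by (simp add: m_def zero_less_measure_iff)
  define I where "I = (\<integral>x. f x \<partial>M)"
  have "0 \<le> (\<integral>x. (f x - I / m)\<^sup>2 \<partial>M)" by simp
  also have "\<dots> = (\<integral>x. (f x)\<^sup>2 - 2 * (I / m) * f x + (I / m)\<^sup>2 \<partial>M)"
    by (intro Bochner_Integration.integral_cong refl) (simp add: power2_eq_square algebra_simps)
  also have "\<dots> = (\<integral>x. (f x)\<^sup>2 \<partial>M) - 2 * (I / m) * I + (I / m)\<^sup>2 * m"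
    using f f2 by (simp add: I_def m_def)
  also have "\<dots> = (\<integral>x. (f x)\<^sup>2 \<partial>M) - I\<^sup>2 / m"
    using m by (simp add: power2_eq_square field_simps)
  finally show ?thesis using m unfolding I_def m_def by (simp add: field_simps)
qed

lemma arc_remainder_cnj:
  assumes "cmod z = 1"
  shows "arc_remainder q n (cnj z) = arc_remainder q n z"
proof -
  have "\<bar>Arg (cnj z)\<bar> = \<bar>Arg z\<bar>"
    by (cases "z \<in> \<real>") (auto simp: Arg_cnj Reals_cnj_iff)
  moreover have "Re (cnj z ^ k) = Re (z ^ k)" for k
    by (metis complex_cnj_power complex_cnj(1) cnj.sel(1))
  ultimately show ?thesis by (simp add: arc_remainder_def arc_indicator_def)
qed

text \<open>
  Vanishing of the moments of orders \<open>1, \<dots>, n\<close> means that the indicator of the arc may be replaced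
  by \<open>arc_remainder q n\<close> under the integral over \<open>M\<close>. The Cauchy-Schwarz inequality and Fubini then
  leave the average of \<open>(arc_remainder q n)\<^sup>2\<close> over a rotated circle.
\<close>

theorem circle_L2_norm_arc_measure:
  fixes M :: "'a measure" and e :: "'a \<Rightarrow> complex" and n q :: nat
  assumes fin: "finite_measure M" and e[measurable]: "e \<in> borel_measurable M"
    and e1: "\<And>u. u \<in> space M \<Longrightarrow> cmod (e u) = 1"
    and moments: "\<And>k. k \<in> {1..n} \<Longrightarrow> (\<integral>u. e u ^ k \<partial>M) = 0"
    and q: "q \<ge> 1" and n: "n \<ge> 1"
  shows "circle_L2_norm (\<lambda>z. measure M {u \<in> space M. \<bar>Arg (cnj z * e u)\<bar> \<le> pi / q} - measure M (space M) / q)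
           \<le> sqrt (2 / (pi\<^sup>2 * n)) * measure M (space M)"
proof -
  interpret finite_measure M by fact
  interpret C: prob_space circle_measure by (rule prob_space_circle_measure)
  interpret P: pair_sigma_finite circle_measure M ..
  interpret PF: finite_measure "circle_measure \<Otimes>\<^sub>M M"
    by (rule finite_measure_pair_measure) unfold_locales
  define m where "m = measure M (space M)"
  define D where "D = arc_remainder q n"
  define B where "B = remainder_bound q n"
  define f where "f z = measure M {u \<in> space M. \<bar>Arg (cnj z * e u)\<bar> \<le> pi / q} - m / q" for z
  have D[measurable]: "D \<in> borel_measurable borel" unfolding D_def by measurable
  have cnj[measurable]: "cnj \<in> borel_measurable borel"
    by (intro borel_measurable_continuous_onI continuous_intros)
  have id_circle[measurable]: "(\<lambda>z. z) \<in> circle_measure \<rightarrow>\<^sub>M (borel :: complex measure)"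
    unfolding circle_measure_def
    by (simp add: measurable_cong_sets[OF sets_distr refl] measurable_restrict_space1)
  have fst[measurable]: "fst \<in> circle_measure \<Otimes>\<^sub>M M \<rightarrow>\<^sub>M (borel :: complex measure)"
    by (rule measurable_compose[OF measurable_fst, of "\<lambda>z. z", simplified]) measurable
  note borel_measurable_Arg[measurable]
  have bound: "\<bar>D (cnj z * e u)\<bar> \<le> B" if "cmod z = 1" "u \<in> space M" for z u
    unfolding D_def B_def by (rule abs_arc_remainder_le[OF q]) (use that e1 in \<open>simp add: norm_mult\<close>)
  have bound2: "(D (cnj z * e u))\<^sup>2 \<le> B\<^sup>2" if "cmod z = 1" "u \<in> space M" for z u
    using power_mono[OF bound[OF that], of 2] by simp
  have int1: "integrable M (\<lambda>u. D (cnj z * e u))" if "cmod z = 1" for z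
    by (rule integrable_const_bound[where B = B]) (use bound that in auto)
  have int2: "integrable M (\<lambda>u. (D (cnj z * e u))\<^sup>2)" if "cmod z = 1" for z
    by (rule integrable_const_bound[where B = "B\<^sup>2"]) (use bound2 that in auto)
  have e_int: "integrable M (\<lambda>u. e u ^ k)" for k
    by (rule integrable_const_bound[where B = 1]) (auto simp: norm_power e1)
  have f_eq: "f z = (\<integral>u. D (cnj z * e u) \<partial>M)" if z: "cmod z = 1" for z
  proof -
    have arc_int: "integrable M (\<lambda>u. arc_indicator q (cnj z * e u))"
      by (rule integrable_const_bound[where B = 1]) (auto simp: arc_indicator_def)
    have trig_int: "integrable M (\<lambda>u. Re ((cnj z * e u) ^ k))" for k
      by (rule integrable_const_bound[where B = 1])
         (auto intro!: order_trans[OF abs_Re_le_cmod] simp: norm_power norm_mult e1 z)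
    have "(\<integral>u. Re ((cnj z * e u) ^ k) \<partial>M) = 0" if "k \<in> {1..n}" for k
    proof -
      have "(\<integral>u. Re ((cnj z * e u) ^ k) \<partial>M) = Re (\<integral>u. cnj z ^ k * e u ^ k \<partial>M)"
        using e_int[of k] by (subst integral_Re) (auto simp: power_mult_distrib)
      thus ?thesis by (simp add: moments[OF that])
    qed
    moreover have "(\<integral>u. arc_indicator q (cnj z * e u) \<partial>M) = measure M {u \<in> space M. \<bar>Arg (cnj z * e u)\<bar> \<le> pi / q}"
    proof -
      have "(\<integral>u. arc_indicator q (cnj z * e u) \<partial>M) = (\<integral>u. indicator {u \<in> space M. \<bar>Arg (cnj z * e u)\<bar> \<le> pi / q} u \<partial>M)"
        by (intro Bochner_Integration.integral_cong) (auto simp: arc_indicator_def)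
      also have "\<dots> = measure M {u \<in> space M. \<bar>Arg (cnj z * e u)\<bar> \<le> pi / q}"
        by simp
      finally show ?thesis .
    qed
    ultimately show ?thesis
      unfolding D_def arc_remainder_def using arc_int trig_int by (simp add: f_def m_def)
  qed
  have circle: "cmod z = 1" if "z \<in> space circle_measure" for z
    using that by (simp add: space_circle_measure)
  have int_prod: "integrable (circle_measure \<Otimes>\<^sub>M M) (\<lambda>(z, u). (D (cnj z * e u))\<^sup>2)"
  proof (rule PF.integrable_const_bound[where B = "B\<^sup>2"])
    show "AE x in circle_measure \<Otimes>\<^sub>M M. norm (case x of (z, u) \<Rightarrow> (D (cnj z * e u))\<^sup>2) \<le> B\<^sup>2"
      by (rule AE_I2) (auto simp: space_pair_measure dest!: circle intro!: bound2)
    have "(\<lambda>x. (D (cnj (fst x) * e (snd x)))\<^sup>2) \<in> borel_measurable (circle_measure \<Otimes>\<^sub>M M)"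
      by measurable
    thus "(\<lambda>(z, u). (D (cnj z * e u))\<^sup>2) \<in> borel_measurable (circle_measure \<Otimes>\<^sub>M M)"
      by (simp add: case_prod_beta')
  qed
  have "(\<integral>z. (f z)\<^sup>2 \<partial>circle_measure) \<le> (\<integral>z. m * (\<integral>u. (D (cnj z * e u))\<^sup>2 \<partial>M) \<partial>circle_measure)"
  proof (rule integral_mono')
    show "integrable circle_measure (\<lambda>z. m * (\<integral>u. (D (cnj z * e u))\<^sup>2 \<partial>M))"
      by (intro integrable_mult_right P.integrable_fst int_prod)
    show "(f z)\<^sup>2 \<le> m * (\<integral>u. (D (cnj z * e u))\<^sup>2 \<partial>M)" if "z \<in> space circle_measure" for z
      unfolding f_eq[OF circle[OF that]] m_def
      by (rule square_integral_le[OF int1 int2]) (rule circle[OF that])+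
  qed (simp add: m_def)
  also have "\<dots> = m * (\<integral>z. (\<integral>u. (D (cnj z * e u))\<^sup>2 \<partial>M) \<partial>circle_measure)"
    by simp
  also have "(\<integral>z. (\<integral>u. (D (cnj z * e u))\<^sup>2 \<partial>M) \<partial>circle_measure)
      = (\<integral>u. (\<integral>z. (D (cnj z * e u))\<^sup>2 \<partial>circle_measure) \<partial>M)"
    by (rule P.Fubini_integral[OF int_prod, symmetric])
  also have "\<dots> = (\<integral>u. (\<integral>z. (D z)\<^sup>2 \<partial>circle_measure) \<partial>M)"
  proof (rule Bochner_Integration.integral_cong[OF refl])
    fix u assume u: "u \<in> space M"
    have "(\<integral>z. (D (cnj z * e u))\<^sup>2 \<partial>circle_measure) = (\<integral>z. (D (z * cnj (e u)))\<^sup>2 \<partial>circle_measure)"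
    proof (intro Bochner_Integration.integral_cong refl)
      fix z assume "z \<in> space circle_measure"
      hence "cmod (z * cnj (e u)) = 1" using circle e1[OF u] by (simp add: norm_mult)
      from arc_remainder_cnj[OF this, of q n] show "(D (cnj z * e u))\<^sup>2 = (D (z * cnj (e u)))\<^sup>2"
        by (simp add: D_def)
    qed
    also have "\<dots> = (\<integral>z. (D z)\<^sup>2 \<partial>circle_measure)"
    proof (rule circle_integral_rotate[where B = "B\<^sup>2"])
      show "\<bar>(D z)\<^sup>2\<bar> \<le> B\<^sup>2" if "cmod z = 1" for z
        using power_mono[OF abs_arc_remainder_le[OF q that, of n], of 2] by (simp add: D_def B_def)
    qed (use e1[OF u] in auto)
    finally show "(\<integral>z. (D (cnj z * e u))\<^sup>2 \<partial>circle_measure) = (\<integral>z. (D z)\<^sup>2 \<partial>circle_measure)" .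
  qed
  also have "\<dots> = m * (\<integral>z. (D z)\<^sup>2 \<partial>circle_measure)" by (simp add: m_def)
  also have "m * (m * (\<integral>z. (D z)\<^sup>2 \<partial>circle_measure)) \<le> m * (m * (2 / (pi\<^sup>2 * n)))"
    unfolding D_def by (intro mult_left_mono arc_remainder_circle_L2 q n) (simp_all add: m_def)
  finally have "(\<integral>z. (f z)\<^sup>2 \<partial>circle_measure) \<le> 2 / (pi\<^sup>2 * n) * m\<^sup>2"
    by (simp add: power2_eq_square mult_ac)
  hence "sqrt (\<integral>z. (f z)\<^sup>2 \<partial>circle_measure) \<le> sqrt (2 / (pi\<^sup>2 * n) * m\<^sup>2)"
    by (rule real_sqrt_le_mono)
  also have "\<dots> = sqrt (2 / (pi\<^sup>2 * n)) * m"
    by (subst real_sqrt_mult) (simp add: m_def)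
  finally show ?thesis by (simp add: circle_L2_norm_def f_def m_def)
qed

section \<open>Angular moments of a mass about a complex hyperplane\<close>

text \<open>
  The coefficients \<open>a = (x 0, \<dots>, x (N - 1))\<close> and \<open>b = x N\<close> are packed into one vector, so that
  unit coefficient vectors form the sphere \<open>csphere N\<close> on which the circle acts by scaling.
\<close>

definition affine_form :: "nat \<Rightarrow> (nat \<Rightarrow> complex) \<Rightarrow> (nat \<Rightarrow> complex) \<Rightarrow> complex" where
  "affine_form N x u = cinner N u x + cnj (x N)"

lemma borel_measurable_affine_form: "affine_form N x \<in> borel_measurable (lborel_C N)"
  unfolding affine_form_def[abs_def] cinner_def lborel_C_def
proof (intro borel_measurable_add borel_measurable_sum borel_measurable_times borel_measurable_const)
  fix i assume "i \<in> {..<N}"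
  thus "(\<lambda>u. u i) \<in> borel_measurable (Pi\<^sub>M {..<N} (\<lambda>_. lborel :: complex measure))"
    using measurable_component_singleton[of i "{..<N}" "\<lambda>_. lborel :: complex measure"] by simp
qed

lemma affine_form_zero_null:
  assumes "i < N" "x i \<noteq> 0"
  shows "{u \<in> cspace N. affine_form N x u = 0} \<in> null_sets (lborel_C N)"
proof -
  interpret product_sigma_finite "\<lambda>_ :: nat. lborel :: complex measure" by standard
  define Z where "Z = {u \<in> cspace N. affine_form N x u = 0}"
  define I where "I = {..<N} - {i}"
  have I: "finite I" "i \<notin> I" "insert i I = {..<N}" using assms by (auto simp: I_def)
  have Z: "Z \<in> sets (lborel_C N)"
    unfolding Z_def using borel_measurable_affine_form[of N x] by measurable
  have "emeasure (lborel_C N) Z = (\<integral>\<^sup>+u. indicator Z u \<partial>Pi\<^sub>M (insert i I) (\<lambda>_. lborel))"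
    using Z by (simp add: I lborel_C_def)
  also have "\<dots> = (\<integral>\<^sup>+y. (\<integral>\<^sup>+t. indicator Z (y(i := t)) \<partial>lborel) \<partial>Pi\<^sub>M I (\<lambda>_. lborel))"
    by (rule product_nn_integral_insert) (use I Z in \<open>auto simp: lborel_C_def\<close>)
  finally have eq: "emeasure (lborel_C N) Z =
      (\<integral>\<^sup>+y. (\<integral>\<^sup>+t. indicator Z (y(i := t)) \<partial>lborel) \<partial>Pi\<^sub>M I (\<lambda>_. lborel))" .
  \<comment> \<open>In the coordinate \<open>i\<close> the equation is affine with nonzero slope, so it has one solution.\<close>
  have inner: "(\<integral>\<^sup>+t. indicator Z (y(i := t)) \<partial>lborel) = (0 :: ennreal)" for y
  proof -
    define c where "c = (\<Sum>l\<in>I. y l * cnj (x l)) + cnj (x N)"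
    have "affine_form N x (y(i := t)) = t * cnj (x i) + c" for t
    proof -
      have "cinner N (y(i := t)) x = (\<Sum>l\<in>insert i I. (y(i := t)) l * cnj (x l))"
        by (simp add: cinner_def I)
      also have "\<dots> = t * cnj (x i) + (\<Sum>l\<in>I. (y(i := t)) l * cnj (x l))"
        using I by (subst sum.insert) auto
      also have "(\<Sum>l\<in>I. (y(i := t)) l * cnj (x l)) = (\<Sum>l\<in>I. y l * cnj (x l))"
        using I by (intro sum.cong) auto
      finally have eq: "cinner N (y(i := t)) x = t * cnj (x i) + (\<Sum>l\<in>I. y l * cnj (x l))" .
      show ?thesis unfolding affine_form_def c_def eq by (rule add.assoc)
    qed
    hence "indicator Z (y(i := t)) \<le> (indicator {- c / cnj (x i)} t :: ennreal)" for t
      using assms(2) by (auto simp: Z_def indicator_def field_simps add_eq_0_iff)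
    hence "(\<integral>\<^sup>+t. indicator Z (y(i := t)) \<partial>lborel) \<le> (\<integral>\<^sup>+t. indicator {- c / cnj (x i)} t \<partial>lborel)"
      by (intro nn_integral_mono)
    also have "\<dots> = 0" by simp
    finally show ?thesis by simp
  qed
  have "emeasure (lborel_C N) Z = 0" unfolding eq inner by simp
  thus ?thesis using Z by (simp add: Z_def null_sets_def)
qed

lemma AE_affine_form_nonzero:
  assumes \<mu>: "mass N \<mu>" and x: "x \<in> csphere N"
  shows "AE u in \<mu>. affine_form N x u \<noteq> 0"
proof (cases "\<exists>i<N. x i \<noteq> 0")
  case True
  then obtain i where "i < N" "x i \<noteq> 0" by blast
  hence "{u \<in> cspace N. affine_form N x u = 0} \<in> null_sets \<mu>"
    using affine_form_zero_null[of i N x] \<mu> by (auto simp: mass_def absolutely_continuous_def)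
  moreover have "space \<mu> = cspace N" using \<mu> by (auto simp: mass_def dest: sets_eq_imp_space_eq)
  ultimately show ?thesis by (auto intro: AE_I')
next
  case False
  hence "(\<Sum>i\<le>N. (cmod (x i))\<^sup>2) = (cmod (x N))\<^sup>2"
    by (simp flip: lessThan_Suc_atMost)
  hence "x N \<noteq> 0" using x by (auto simp: csphere_def)
  moreover have "affine_form N x u = cnj (x N)" for u
    using False by (simp add: affine_form_def cinner_def)
  ultimately show ?thesis by simp
qed

text \<open>
  The conjugate makes the moment homogeneous of degree \<open>k\<close> in \<open>x\<close>, because \<open>affine_form\<close> is
  conjugate linear in \<open>x\<close>.
\<close>

definition angular_moment :: "nat \<Rightarrow> (nat \<Rightarrow> complex) measure \<Rightarrow> nat \<Rightarrow> (nat \<Rightarrow> complex) \<Rightarrow> complex" where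
  "angular_moment N \<mu> k x = (\<integral>u. sgn (cnj (affine_form N x u)) ^ k \<partial>\<mu>)"

lemma angular_moment_scale:
  assumes "cmod c = 1"
  shows "angular_moment N \<mu> k (\<lambda>l. c * x l) = c ^ k * angular_moment N \<mu> k x"
proof -
  have "affine_form N (\<lambda>l. c * x l) u = cnj c * affine_form N x u" for u
    by (simp add: affine_form_def cinner_def distrib_left sum_distrib_left mult_ac)
  hence "sgn (cnj (affine_form N (\<lambda>l. c * x l) u)) ^ k = c ^ k * sgn (cnj (affine_form N x u)) ^ k" for u
    using assms by (simp add: sgn_mult sgn_div_norm[of c] power_mult_distrib)
  thus ?thesis by (simp add: angular_moment_def)
qed

lemma borel_measurable_sgn_affine_form:
  assumes "mass N \<mu>"
  shows "affine_form N x \<in> borel_measurable \<mu>" "(\<lambda>u. sgn (affine_form N x u)) \<in> borel_measurable \<mu>"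
    "(\<lambda>u. sgn (cnj (affine_form N x u)) ^ k) \<in> borel_measurable \<mu>"
proof -
  have cnj[measurable]: "cnj \<in> borel_measurable borel"
    by (intro borel_measurable_continuous_onI continuous_intros)
  show [measurable]: "affine_form N x \<in> borel_measurable \<mu>"
    using borel_measurable_affine_form[of N x] assms
    by (simp add: mass_def cong: measurable_cong_sets)
  show "(\<lambda>u. sgn (affine_form N x u)) \<in> borel_measurable \<mu>"
    "(\<lambda>u. sgn (cnj (affine_form N x u)) ^ k) \<in> borel_measurable \<mu>"
    unfolding sgn_div_norm by measurable
qed

text \<open>
  Dominated convergence: the integrand is bounded, and it is continuous in \<open>x\<close> wherever the affine
  form does not vanish, hence almost everywhere because a mass does not charge hyperplanes.
\<close>

lemma continuous_on_angular_moment: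
  assumes \<mu>: "mass N \<mu>"
  shows "continuous_on (csphere N) (angular_moment N \<mu> k)"
proof (rule continuous_on_sequentiallyI)
  fix X :: "nat \<Rightarrow> nat \<Rightarrow> complex" and x
  assume "\<forall>n. X n \<in> csphere N" and x: "x \<in> csphere N" and lim: "X \<longlonglongrightarrow> x"
  interpret finite_measure \<mu> using \<mu> by (simp add: mass_def)
  have coord: "(\<lambda>n. X n i) \<longlonglongrightarrow> x i" for i
  proof (rule isCont_tendsto_compose[OF _ lim, of "\<lambda>y. y i"])
    have "continuous_on UNIV (\<lambda>y :: nat \<Rightarrow> complex. y i)"
      by (rule continuous_on_product_then_coordinatewise[OF continuous_on_id])
    thus "isCont (\<lambda>y. y i) x" using continuous_on_eq_continuous_at[OF open_UNIV] by blast
  qed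
  show "(\<lambda>n. angular_moment N \<mu> k (X n)) \<longlonglongrightarrow> angular_moment N \<mu> k x"
    unfolding angular_moment_def
  proof (rule integral_dominated_convergence[where w = "\<lambda>_. 1"])
    show "AE u in \<mu>. (\<lambda>n. sgn (cnj (affine_form N (X n) u)) ^ k) \<longlonglongrightarrow> sgn (cnj (affine_form N x u)) ^ k"
      using AE_affine_form_nonzero[OF \<mu> x]
    proof eventually_elim
      case (elim u)
      have "(\<lambda>n. affine_form N (X n) u) \<longlonglongrightarrow> affine_form N x u"
        unfolding affine_form_def cinner_def by (intro tendsto_intros coord)
      with elim show ?case by (intro tendsto_intros) auto
    qed
    show "AE u in \<mu>. norm (sgn (cnj (affine_form N (X n) u)) ^ k) \<le> 1" for n
      by (intro AE_I2) (auto simp: norm_power norm_sgn power_le_one)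
  qed (auto intro: borel_measurable_sgn_affine_form[OF \<mu>])
qed

text \<open>
  Up to a null set, membership in a sector depends only on the direction of the affine form.
\<close>

lemma sector_L2_estimate:
  assumes \<mu>: "mass N \<mu>" and x: "x \<in> csphere N" and q: "q \<ge> 1" and n: "n \<ge> 1"
    and zero: "\<And>k. k \<in> {1..n} \<Longrightarrow> angular_moment N \<mu> k x = 0"
  shows "circle_L2_norm (\<lambda>z. measure \<mu> (sector N q x (x N) z) - measure \<mu> (cspace N) / q)
           \<le> sqrt (2 / (pi\<^sup>2 * n)) * measure \<mu> (cspace N)"
proof -
  interpret finite_measure \<mu> using \<mu> by (simp add: mass_def)
  have space: "space \<mu> = cspace N" using \<mu> by (auto simp: mass_def dest: sets_eq_imp_space_eq)
  note [measurable] = borel_measurable_sgn_affine_form[OF \<mu>]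
  note borel_measurable_Arg[measurable]
  define e where "e u = (if affine_form N x u = 0 then 1 else sgn (affine_form N x u))" for u
  have e[measurable]: "e \<in> borel_measurable \<mu>" unfolding e_def[abs_def] by measurable
  have nz: "AE u in \<mu>. affine_form N x u \<noteq> 0" by (rule AE_affine_form_nonzero[OF \<mu> x])
  have moments: "(\<integral>u. e u ^ k \<partial>\<mu>) = 0" if k: "k \<in> {1..n}" for k
  proof -
    have "(\<integral>u. e u ^ k \<partial>\<mu>) = (\<integral>u. cnj (sgn (cnj (affine_form N x u)) ^ k) \<partial>\<mu>)"
    proof (rule integral_cong_AE)
      show "AE u in \<mu>. e u ^ k = cnj (sgn (cnj (affine_form N x u)) ^ k)"
        using nz by eventually_elim (simp add: e_def sgn_div_norm)
      have "cnj \<in> borel_measurable borel"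
        by (intro borel_measurable_continuous_onI continuous_intros)
      thus "(\<lambda>u. cnj (sgn (cnj (affine_form N x u)) ^ k)) \<in> borel_measurable \<mu>"
        by measurable
    qed measurable
    also have "\<dots> = cnj (angular_moment N \<mu> k x)"
      unfolding angular_moment_def by (rule Bochner_Integration.integral_cnj)
    finally show ?thesis by (simp add: zero[OF k])
  qed
  have eq: "measure \<mu> (sector N q x (x N) z) = measure \<mu> {u \<in> space \<mu>. \<bar>Arg (cnj z * e u)\<bar> \<le> pi / q}"
    if z: "z \<in> sphere 0 1" for z
  proof (rule finite_measure_eq_AE)
    have sector: "sector N q x (x N) z =
        {u \<in> space \<mu>. affine_form N x u = 0 \<or> \<bar>Arg (cnj z * affine_form N x u)\<bar> \<le> pi / q}"
      by (simp add: sector_eq[OF z] space affine_form_def)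
    show "AE u in \<mu>. u \<in> sector N q x (x N) z \<longleftrightarrow> u \<in> {u \<in> space \<mu>. \<bar>Arg (cnj z * e u)\<bar> \<le> pi / q}"
      using nz
    proof eventually_elim
      case (elim u)
      have "cnj z * e u = of_real (1 / cmod (affine_form N x u)) * (cnj z * affine_form N x u)"
        using elim by (simp add: e_def sgn_div_norm scaleR_conv_of_real divide_inverse mult_ac)
      also have "Arg \<dots> = Arg (cnj z * affine_form N x u)"
        using elim by (intro Arg_times_of_real) simp
      finally show ?case using elim by (simp add: sector)
    qed
    show "sector N q x (x N) z \<in> sets \<mu>" unfolding sector by measurable
  qed measurable
  have "circle_L2_norm (\<lambda>z. measure \<mu> (sector N q x (x N) z) - measure \<mu> (cspace N) / q)
      = circle_L2_norm (\<lambda>z. measure \<mu> {u \<in> space \<mu>. \<bar>Arg (cnj z * e u)\<bar> \<le> pi / q} - measure \<mu> (space \<mu>) / q)"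
    unfolding circle_L2_norm_def
    by (intro arg_cong[where f = sqrt] Bochner_Integration.integral_cong refl)
       (simp add: eq space_circle_measure space)
  also have "\<dots> \<le> sqrt (2 / (pi\<^sup>2 * n)) * measure \<mu> (space \<mu>)"
    by (rule circle_L2_norm_arc_measure[OF finite_measure_axioms e _ moments q n])
       (auto simp: e_def norm_sgn)
  finally show ?thesis by (simp add: space)
qed

lemma sqrt_tail_bound_less:
  assumes "n \<ge> (1::nat)"
  shows "sqrt (2 / (pi\<^sup>2 * n)) < 1 / sqrt n"
proof -
  have "2 < pi\<^sup>2" using pi_gt3 power_mono[of 3 pi 2] by simp
  hence "2 / (pi\<^sup>2 * n) < 1 / n" using assms by (simp add: field_simps)
  hence "sqrt (2 / (pi\<^sup>2 * n)) < sqrt (1 / n)" by (rule real_sqrt_less_mono)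
  thus ?thesis by (simp add: real_sqrt_divide)
qed

theorem corollary1p3:
  shows "\<exists>\<kappa>::real. \<kappa> > 0 \<and>
    (\<forall>(d::nat) (n::nat) (q::nat) (\<mu> :: nat \<Rightarrow> (nat \<Rightarrow> complex) measure).
      d \<ge> 1 \<longrightarrow> n \<ge> 1 \<longrightarrow> q \<ge> 2 \<longrightarrow>
      (\<forall>j\<in>{1..d}. mass (d * n) (\<mu> j) \<and> measure (\<mu> j) (cspace (d * n)) \<noteq> 0) \<longrightarrow>
      (\<exists>H S. complex_hyperplane (d * n) H \<and> regular_sectors (d * n) q H S \<and>
        (\<forall>j\<in>{1..d}.
          circle_L2_norm (\<lambda>z. measure (\<mu> j) (S z) - measure (\<mu> j) (cspace (d * n)) / real q)
            < \<kappa> / sqrt (real n) * measure (\<mu> j) (cspace (d * n)))))"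
proof (intro exI[of _ 1] conjI allI impI)
  fix d n q :: nat and \<mu> :: "nat \<Rightarrow> (nat \<Rightarrow> complex) measure"
  assume d: "d \<ge> 1" and n: "n \<ge> 1" and q: "q \<ge> 2"
    and \<mu>: "\<forall>j\<in>{1..d}. mass (d * n) (\<mu> j) \<and> measure (\<mu> j) (cspace (d * n)) \<noteq> 0"
  define N where "N = d * n"
  have mass: "mass N (\<mu> j)" and pos: "measure (\<mu> j) (cspace N) > 0" if "j \<in> {1..d}" for j
    using \<mu> that by (auto simp: N_def zero_less_measure_iff)
  have index: "i div n + 1 \<in> {1..d}" if "i < N" for i
    using that by (simp add: N_def less_mult_imp_div_less Suc_leI)
  \<comment> \<open>The index \<open>i\<close> enumerates the pairs of a mass \<open>i div n + 1\<close> and an order \<open>i mod n + 1\<close>.\<close>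
  have "\<exists>x\<in>csphere N. \<forall>i<N. angular_moment N (\<mu> (i div n + 1)) (i mod n + 1) x = 0"
    by (rule circle_equivariant_maps_common_zero[where k = "\<lambda>i. i mod n + 1"])
       (simp_all add: continuous_on_angular_moment mass[OF index, simplified] angular_moment_scale)
  then obtain x where x: "x \<in> csphere N"
    and zero: "\<And>i. i < N \<Longrightarrow> angular_moment N (\<mu> (i div n + 1)) (i mod n + 1) x = 0" by blast
  have moments: "angular_moment N (\<mu> j) k x = 0" if "j \<in> {1..d}" "k \<in> {1..n}" for j k
  proof -
    have "(j - 1) * n + (k - 1) < N"
    proof -
      have "(j - 1) * n + (k - 1) < (j - 1) * n + n" using that by auto
      also have "\<dots> = j * n" using that by (simp add: algebra_simps)
      also have "\<dots> \<le> N" using that by (simp add: N_def)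
      finally show ?thesis .
    qed
    from zero[OF this] show ?thesis using that n by auto
  qed
  define a where "a = restrict x {..<N}"
  define b where "b = x N"
  \<comment> \<open>Otherwise the affine form is a nonzero constant, and the first moment does not vanish.\<close>
  have "\<exists>i<N. x i \<noteq> 0"
  proof (rule ccontr)
    assume no: "\<not> (\<exists>i<N. x i \<noteq> 0)"
    have one: "1 \<in> {1..d}" using d by simp
    have "space (\<mu> 1) = cspace N"
      using mass[OF one] by (auto simp: mass_def dest: sets_eq_imp_space_eq)
    hence "angular_moment N (\<mu> 1) 1 x = measure (\<mu> 1) (cspace N) *\<^sub>R sgn (x N)"
      using no by (simp add: angular_moment_def affine_form_def cinner_def)
    moreover have "angular_moment N (\<mu> 1) 1 x = 0" by (rule moments[OF one]) (use n in simp)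
    ultimately have "x N = 0" using pos[OF one] by (simp add: sgn_zero_iff)
    with no have "x i = 0" if "i \<le> N" for i using that by (cases "i = N") auto
    hence "(\<Sum>i\<le>N. (cmod (x i))\<^sup>2) = 0" by simp
    with x show False by (simp add: csphere_def)
  qed
  hence coeffs: "hyperplane_coeffs N a b"
    using x by (auto simp: hyperplane_coeffs_def cspace_eq a_def b_def csphere_def simp flip: lessThan_Suc_atMost)
  have sector: "sector N q a b z = sector N q x (x N) z" for z
    by (simp add: sector_def a_def b_def cinner_def)
  show "\<exists>H S. complex_hyperplane (d * n) H \<and> regular_sectors (d * n) q H S \<and>
        (\<forall>j\<in>{1..d}.
          circle_L2_norm (\<lambda>z. measure (\<mu> j) (S z) - measure (\<mu> j) (cspace (d * n)) / real q)
            < 1 / sqrt (real n) * measure (\<mu> j) (cspace (d * n)))"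
    unfolding N_def[symmetric]
  proof (intro exI conjI ballI)
    show "complex_hyperplane N (hyperplane N a b)"
      using coeffs by (auto simp: complex_hyperplane_def)
    show "regular_sectors N q (hyperplane N a b) (sector N q a b)"
      using coeffs by (auto simp: regular_sectors_def)
    fix j assume j: "j \<in> {1..d}"
    have "circle_L2_norm (\<lambda>z. measure (\<mu> j) (sector N q a b z) - measure (\<mu> j) (cspace N) / real q)
        \<le> sqrt (2 / (pi\<^sup>2 * n)) * measure (\<mu> j) (cspace N)"
      unfolding sector by (rule sector_L2_estimate[OF mass[OF j] x _ n moments[OF j]]) (use q in auto)
    also have "\<dots> < 1 / sqrt n * measure (\<mu> j) (cspace N)"
      by (intro mult_strict_right_mono sqrt_tail_bound_less n pos[OF j])
    finally show "circle_L2_norm (\<lambda>z. measure (\<mu> j) (sector N q a b z) - measure (\<mu> j) (cspace N) / real q)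
        < 1 / sqrt n * measure (\<mu> j) (cspace N)" .
  qed
qed simp

end
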